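(* Let $\Delta t>0$ and $n\ge0$. Given $u_h^{n-1},u_h^n\in V_h$ and $U^n\in C^0(\Omega)$, put $u_h^{n,*}=\frac32u_h^n-\frac12u_h^{n-1}$ and consider the scheme: find $u_h^{n+1}\in V_h$ and $U^{n+1}\in C^0(\Omega)$ such that, with $u_h^{n+1/2}=\frac12(u_h^n+u_h^{n+1})$ and $U^{n+1/2}=\frac12(U^n+U^{n+1})$, for all $\phi\in V_h$ $$\left(\frac{u_h^{n+1/2}-u_h^n}{\frac12\Delta t},\phi\right)=-A(\epsilon^2;u_h^{n+1/2},\phi)-\left(H(u_h^{n,*})U^{n+1/2},\phi\right),$$ $$\frac{U^{n+1/2}-U^n}{\frac12\Delta t}=\frac12H(u_h^{n,*})\frac{u_h^{n+1/2}-u_h^n}{\frac12\Delta t}\quad\text{(pointwise)}.$$ Then for any $\Delta t>0$ the scheme admits a unique solution $u_h^{n+1}\in V_h$, $U^{n+1}\in C^0(\Omega)$, and it satisfies the energy dissipation law $$E(u_h^{n+1},U^{n+1})=E(u_h^n,U^n)-\frac1{\Delta t}\|u_h^{n+1}-u_h^n\|^2.$$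
   Context: $\Omega\subset\mathbb{R}^d$ ($d=2,3$) is a bounded domain and $\epsilon>0$ is a constant. $\mathcal T$ is a quasi-uniform triangulation $\Omega=\cup_{i=1}^N T_i$, and $V_h=\{v\in C^0(\Omega)\cap H^1(\Omega): v|_{T_i}\in P_k\ \forall T_i\in\mathcal T\}$, where $P_k$ is the space of polynomials of degree at most $k$ ($k\ge1$ fixed). $C^0(\Omega)$ denotes functions continuous on $\overline\Omega$. $(\cdot,\cdot)$ and $\|\cdot\|$ are the $L^2(\Omega)$ inner product and norm. For a coefficient $a(x)$, $A(a;q,v)=\int_\Omega a(x)\nabla q\cdot\nabla v\,dx$. The potential $F$ is a $C^1$ function on an interval $I\subseteq\mathbb{R}$ (e.g. $F(u)=\frac14(u^2-1)^2$ with $I=\mathbb{R}$, or the logarithmic Flory–Huggins potential with $I=(0,1)$). The constant $B\ge0$ is such that $F+B>0$, and $H(w)=F'(w)/\sqrt{F(w)+B}$. It is a standing assumption that all functions at which $F,F',H$ are evaluated take values (on $\overline\Omega$) where these are defined and $F+B>0$. The energy is $E(v,V)=\frac12A(\epsilon^2;v,v)+\int_\Omega V^2\,dx-B|\Omega|$. *)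

theory Defs
  imports "HOL-Analysis.Analysis"
begin

text \<open>Functions on the closure of the domain \<open>\<Omega>\<close> are represented by total functions on \<open>real ^ 'd\<close>;
  the function spaces, forms, energy and scheme below depend only on the values on
  \<open>closure \<Omega>\<close>.\<close>

definition bounded_domain :: "(real ^ 'd::finite) set \<Rightarrow> bool" where
  "bounded_domain \<Omega> \<longleftrightarrow> open \<Omega> \<and> connected \<Omega> \<and> \<Omega> \<noteq> {} \<and> bounded \<Omega>"

definition C0 :: "(real ^ 'd::finite) set \<Rightarrow> (real ^ 'd \<Rightarrow> real) set" where
  "C0 \<Omega> = {v. continuous_on (closure \<Omega>) v}"

definition L2 :: "(real ^ 'd::finite) set \<Rightarrow> (real ^ 'd \<Rightarrow> 'b::euclidean_space) set" where
  "L2 \<Omega> = {f \<in> borel_measurable (lebesgue_on \<Omega>). integrable (lebesgue_on \<Omega>) (\<lambda>x. (norm (f x))\<^sup>2)}"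

definition l2_inner :: "(real ^ 'd::finite) set \<Rightarrow> (real ^ 'd \<Rightarrow> real) \<Rightarrow> (real ^ 'd \<Rightarrow> real) \<Rightarrow> real" where
  "l2_inner \<Omega> f g = (LINT x|lebesgue_on \<Omega>. f x * g x)"

definition l2_norm :: "(real ^ 'd::finite) set \<Rightarrow> (real ^ 'd \<Rightarrow> real) \<Rightarrow> real" where
  "l2_norm \<Omega> f = sqrt (l2_inner \<Omega> f f)"

definition partial :: "'d \<Rightarrow> (real ^ 'd::finite \<Rightarrow> real) \<Rightarrow> real ^ 'd \<Rightarrow> real" where
  "partial i f x = frechet_derivative f (at x) (axis i 1)"

primrec C_class :: "nat \<Rightarrow> (real ^ 'd::finite \<Rightarrow> real) \<Rightarrow> bool" where
  "C_class 0 f \<longleftrightarrow> continuous_on UNIV f"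
| "C_class (Suc m) f \<longleftrightarrow> (\<forall>x. f differentiable (at x)) \<and> (\<forall>i. C_class m (partial i f))"

definition test_functions :: "(real ^ 'd::finite) set \<Rightarrow> (real ^ 'd \<Rightarrow> real) set" where
  "test_functions \<Omega> = {\<phi>. (\<forall>m. C_class m \<phi>) \<and>
     compact (closure {x. \<phi> x \<noteq> 0}) \<and> closure {x. \<phi> x \<noteq> 0} \<subseteq> \<Omega>}"

definition L2_weak_gradient ::
  "(real ^ 'd::finite) set \<Rightarrow> (real ^ 'd \<Rightarrow> real) \<Rightarrow> (real ^ 'd \<Rightarrow> real ^ 'd) \<Rightarrow> bool" where
  "L2_weak_gradient \<Omega> v g \<longleftrightarrow> g \<in> L2 \<Omega> \<and>
     (\<forall>\<phi>\<in>test_functions \<Omega>. \<forall>i.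
        (LINT x|lebesgue_on \<Omega>. v x * partial i \<phi> x) = - (LINT x|lebesgue_on \<Omega>. g x $ i * \<phi> x))"

definition H1 :: "(real ^ 'd::finite) set \<Rightarrow> (real ^ 'd \<Rightarrow> real) set" where
  "H1 \<Omega> = {v \<in> L2 \<Omega>. \<exists>g. L2_weak_gradient \<Omega> v g}"

text \<open>The weak gradient is unique only up to null sets, hence the choice of a representative;
  it is used under integrals over \<open>\<Omega>\<close> only.\<close>

definition weak_grad :: "(real ^ 'd::finite) set \<Rightarrow> (real ^ 'd \<Rightarrow> real) \<Rightarrow> real ^ 'd \<Rightarrow> real ^ 'd" where
  "weak_grad \<Omega> v = (SOME g. L2_weak_gradient \<Omega> v g)"

definition A_form ::
  "(real ^ 'd::finite) set \<Rightarrow> (real ^ 'd \<Rightarrow> real) \<Rightarrow> (real ^ 'd \<Rightarrow> real) \<Rightarrow> (real ^ 'd \<Rightarrow> real) \<Rightarrow> real" where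
  "A_form \<Omega> a q v = (LINT x|lebesgue_on \<Omega>. a x * (weak_grad \<Omega> q x \<bullet> weak_grad \<Omega> v x))"

definition domain_triangulation :: "(real ^ 'd::finite) set \<Rightarrow> (real ^ 'd) set set \<Rightarrow> bool" where
  "domain_triangulation \<Omega> \<T> \<longleftrightarrow> triangulation \<T> \<and>
     (\<forall>T\<in>\<T>. int CARD('d) simplex T) \<and> \<Union>\<T> = closure \<Omega>"

text \<open>With mesh size \<open>h = Max (diameter ` \<T>)\<close>, every element contains a ball of radius \<open>\<rho> h\<close>.
  This bounds both the shape regularity and the ratio of element sizes.\<close>

definition quasi_uniform :: "real \<Rightarrow> (real ^ 'd::finite) set set \<Rightarrow> bool" where
  "quasi_uniform \<rho> \<T> \<longleftrightarrow> (\<forall>T\<in>\<T>. \<exists>x. cball x (\<rho> * Max (diameter ` \<T>)) \<subseteq> T)"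

text \<open>Polynomials of total degree at most \<open>k\<close>; \<open>\<alpha>\<close> ranges over the finitely many multi-indices
  with \<open>\<bar>\<alpha>\<bar> \<le> k\<close>.\<close>

definition poly_space :: "nat \<Rightarrow> (real ^ 'd::finite \<Rightarrow> real) set" where
  "poly_space k = {p. \<exists>c :: ('d \<Rightarrow> nat) \<Rightarrow> real.
     p = (\<lambda>x. \<Sum>\<alpha> | (\<Sum>i\<in>UNIV. \<alpha> i) \<le> k. c \<alpha> * (\<Prod>i\<in>UNIV. (x $ i) ^ \<alpha> i))}"

definition fe_space :: "(real ^ 'd::finite) set \<Rightarrow> (real ^ 'd) set set \<Rightarrow> nat \<Rightarrow> (real ^ 'd \<Rightarrow> real) set" where
  "fe_space \<Omega> \<T> k = {v \<in> C0 \<Omega> \<inter> H1 \<Omega>. \<forall>T\<in>\<T>. \<exists>p\<in>poly_space k. \<forall>x\<in>T. v x = p x}"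

definition C1_on :: "real set \<Rightarrow> (real \<Rightarrow> real) \<Rightarrow> (real \<Rightarrow> real) \<Rightarrow> bool" where
  "C1_on I F F' \<longleftrightarrow> (\<forall>w\<in>I. (F has_real_derivative F' w) (at w within I)) \<and> continuous_on I F'"

definition H_fun :: "(real \<Rightarrow> real) \<Rightarrow> (real \<Rightarrow> real) \<Rightarrow> real \<Rightarrow> real \<Rightarrow> real" where
  "H_fun F F' B w = F' w / sqrt (F w + B)"

definition energy ::
  "(real ^ 'd::finite) set \<Rightarrow> real \<Rightarrow> real \<Rightarrow> (real ^ 'd \<Rightarrow> real) \<Rightarrow> (real ^ 'd \<Rightarrow> real) \<Rightarrow> real" where
  "energy \<Omega> \<epsilon> B v V = 1/2 * A_form \<Omega> (\<lambda>_. \<epsilon>\<^sup>2) v v + (LINT x|lebesgue_on \<Omega>. (V x)\<^sup>2)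
     - B * measure lebesgue \<Omega>"

definition extrapolate :: "(real ^ 'd::finite \<Rightarrow> real) \<Rightarrow> (real ^ 'd \<Rightarrow> real) \<Rightarrow> real ^ 'd \<Rightarrow> real" where
  "extrapolate u_prev u x = 3/2 * u x - 1/2 * u_prev x"

definition midpt :: "(real ^ 'd::finite \<Rightarrow> real) \<Rightarrow> (real ^ 'd \<Rightarrow> real) \<Rightarrow> real ^ 'd \<Rightarrow> real" where
  "midpt f g x = 1/2 * (f x + g x)"

text \<open>\<open>(u', U')\<close> is a solution at the new time level for the data \<open>u_prev\<close>, \<open>u\<close>, \<open>U\<close>.\<close>

definition scheme_solution ::
  "(real ^ 'd::finite) set \<Rightarrow> (real ^ 'd \<Rightarrow> real) set \<Rightarrow> real \<Rightarrow> (real \<Rightarrow> real) \<Rightarrow> real \<Rightarrow>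
   (real ^ 'd \<Rightarrow> real) \<Rightarrow> (real ^ 'd \<Rightarrow> real) \<Rightarrow> (real ^ 'd \<Rightarrow> real) \<Rightarrow>
   (real ^ 'd \<Rightarrow> real) \<Rightarrow> (real ^ 'd \<Rightarrow> real) \<Rightarrow> bool" where
  "scheme_solution \<Omega> Vh \<epsilon> H \<Delta>t u_prev u U u' U' \<longleftrightarrow>
     u' \<in> Vh \<and> U' \<in> C0 \<Omega> \<and>
     (\<forall>\<phi>\<in>Vh. l2_inner \<Omega> (\<lambda>x. (midpt u u' x - u x) / (1/2 * \<Delta>t)) \<phi> =
        - A_form \<Omega> (\<lambda>_. \<epsilon>\<^sup>2) (midpt u u') \<phi>
        - l2_inner \<Omega> (\<lambda>x. H (extrapolate u_prev u x) * midpt U U' x) \<phi>) \<and>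
     (\<forall>x\<in>closure \<Omega>. (midpt U U' x - U x) / (1/2 * \<Delta>t) =
        1/2 * H (extrapolate u_prev u x) * ((midpt u u' x - u x) / (1/2 * \<Delta>t)))"

end

theory Submission
  imports Defs "HOL-Computational_Algebra.Polynomial"
begin

text \<open>The update of \<open>U\<close> is explicit once the midpoint \<open>w\<close> of \<open>u\<close> and \<open>u'\<close> is known:
  \<open>U' = U + h (w - u)\<close>, where \<open>h\<close> is the coefficient \<open>H\<close> at the extrapolated value. Eliminating \<open>U'\<close>
  leaves a linear variational problem for \<open>w\<close> in the finite element space, whose form
  \<open>((2 / \<Delta>t + h\<^sup>2 / 2) w, \<phi>) + A(\<epsilon>\<^sup>2; w, \<phi>)\<close> is symmetric and positive definite for every \<open>\<Delta>t > 0\<close>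
  (\<open>solution_iff_reduced\<close>, \<open>reduced_form_positive\<close>). The space is finite-dimensional, because an element of it
  is given on the closure of \<open>\<Omega>\<close> by finitely many polynomial coefficients, so a Riesz representation theorem
  proved by induction on the number of generators gives the solution (\<open>finite_dimensional_riesz\<close>); definiteness
  gives uniqueness. The energy law is the scheme tested with \<open>u' - u\<close> (\<open>energy_dissipation\<close>).

  All of this needs \<open>A\<close> to be bilinear, although it is built from arbitrarily chosen weak gradients. Bilinearity
  holds because weak gradients are unique almost everywhere (\<open>weak_gradient_unique\<close>), which is the fundamental
  lemma of the calculus of variations (\<open>fundamental_lemma_calculus_of_variations\<close>). That lemma in turn requires
  enough smooth compactly supported functions. They are products of one-dimensional functions
  \<open>exp (- 1 / t)\<close>, sharpened so that they converge to indicators of boxes (\<open>box_bump\<close>).\<close>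

section \<open>Smooth bump functions on boxes\<close>

lemma C_class_continuous: "C_class m f \<Longrightarrow> continuous_on UNIV f"
  by (cases m) (auto intro!: continuous_at_imp_continuous_on differentiable_imp_continuous_within)

lemma C_class_Suc_imp: "C_class (Suc m) f \<Longrightarrow> C_class m f"
proof (induction m arbitrary: f)
  case 0
  then show ?case using C_class_continuous[OF "0"] by simp
next
  case (Suc m)
  then show ?case by (metis C_class.simps(2))
qed

lemma partial_eqI: "(f has_derivative D) (at x) \<Longrightarrow> partial i f x = D (axis i 1)"
  unfolding partial_def by (simp add: frechet_derivative_at[symmetric])

lemma C_class_add: "C_class m f \<Longrightarrow> C_class m g \<Longrightarrow> C_class m (\<lambda>x. f x + g x)"
proof (induction m arbitrary: f g)
  case 0
  then show ?case by (auto intro: continuous_intros)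
next
  case (Suc m)
  have "partial i (\<lambda>x. f x + g x) = (\<lambda>x. partial i f x + partial i g x)" for i
  proof
    fix x
    have "(f has_derivative frechet_derivative f (at x)) (at x)"
      "(g has_derivative frechet_derivative g (at x)) (at x)"
      using Suc.prems by (auto simp: frechet_derivative_works)
    from has_derivative_add[OF this] show "partial i (\<lambda>x. f x + g x) x = partial i f x + partial i g x"
      by (subst partial_eqI) (auto simp: partial_def)
  qed
  then show ?case using Suc by auto
qed

text \<open>The induction needs the factors themselves, not only their partial derivatives, to be in the class
  one order below; this is where \<open>C_class_Suc_imp\<close> enters.\<close>

lemma C_class_mult: "C_class m f \<Longrightarrow> C_class m g \<Longrightarrow> C_class m (\<lambda>x. f x * g x)"
proof (induction m arbitrary: f g)
  case 0
  then show ?case by (auto intro: continuous_intros)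
next
  case (Suc m)
  have eq: "partial i (\<lambda>x. f x * g x) = (\<lambda>x. f x * partial i g x + partial i f x * g x)" for i
  proof
    fix x
    have "(f has_derivative frechet_derivative f (at x)) (at x)"
      "(g has_derivative frechet_derivative g (at x)) (at x)"
      using Suc.prems by (auto simp: frechet_derivative_works)
    from has_derivative_mult[OF this]
    show "partial i (\<lambda>x. f x * g x) x = f x * partial i g x + partial i f x * g x"
      by (subst partial_eqI) (auto simp: partial_def)
  qed
  have "C_class m (\<lambda>x. f x * partial i g x + partial i f x * g x)" for i
    using Suc.prems C_class_Suc_imp by (intro C_class_add Suc.IH) (auto simp del: C_class.simps(1))
  then show ?case using Suc.prems by (auto simp: eq)
qed

lemma C_class_const: "C_class m (\<lambda>_. c)"
proof (induction m arbitrary: c)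
  case (Suc m)
  have "partial i (\<lambda>_. c) = (\<lambda>_. 0)" for i :: 'a
    by (rule ext, subst partial_eqI) (auto intro!: derivative_eq_intros)
  then show ?case using Suc by auto
qed auto

lemma C_class_prod: "finite J \<Longrightarrow> (\<And>j. j \<in> J \<Longrightarrow> C_class m (f j)) \<Longrightarrow> C_class m (\<lambda>x. \<Prod>j\<in>J. f j x)"
  by (induction J rule: finite_induct) (auto simp: C_class_const C_class_mult)

lemma C_class_affine_coordinate:
  fixes F :: "nat \<Rightarrow> real \<Rightarrow> real"
  assumes F: "\<And>n t. (F n has_real_derivative F (Suc n) t) (at t)"
  shows "C_class m (\<lambda>x::real^'d::finite. F n (c * x $ j + d))"
proof (induction m arbitrary: n)
  case 0
  have "continuous_on UNIV (F n)"
    by (auto intro!: continuous_at_imp_continuous_on DERIV_isCont F)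
  then show ?case
    by (auto intro!: continuous_intros continuous_on_compose2[of UNIV "F n"])
next
  case (Suc m)
  have D: "((\<lambda>x::real^'d. F n (c * x $ j + d)) has_derivative (\<lambda>v. F (Suc n) (c * x $ j + d) * (c * v $ j))) (at x)" for x
  proof -
    have "((\<lambda>x::real^'d. c * x $ j + d) has_derivative (\<lambda>v. c * v $ j)) (at x)"
      by (auto intro!: derivative_eq_intros bounded_linear_imp_has_derivative bounded_linear_vec_nth)
    from has_derivative_compose[OF this F[of n, unfolded has_field_derivative_def]]
    show ?thesis by simp
  qed
  have "partial i (\<lambda>x::real^'d. F n (c * x $ j + d)) =
      (\<lambda>x. (c * axis i 1 $ j) * F (Suc n) (c * x $ j + d))" for i
    by (rule ext, subst partial_eqI[OF D]) simp
  moreover have "C_class m (\<lambda>x::real^'d. (c * axis i 1 $ j) * F (Suc n) (c * x $ j + d))" for i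
    by (intro C_class_mult C_class_const Suc.IH)
  ultimately show ?case using D by (auto simp: differentiable_def)
qed

text \<open>For \<open>p = 1\<close> this is the classical smooth function that is flat at the origin. Carrying a polynomial in
  \<open>1 / t\<close> makes the family closed under differentiation, so that all derivatives are available at once.\<close>

definition flat_exp :: "real poly \<Rightarrow> real \<Rightarrow> real" where
  "flat_exp p t = (if t > 0 then poly p (1 / t) * exp (- 1 / t) else 0)"

lemma poly_times_exp_tendsto_0: "((\<lambda>s::real. poly p s * exp (- s)) \<longlongrightarrow> 0) at_top"
proof -
  have "((\<lambda>s::real. \<Sum>i\<le>degree p. coeff p i * (s ^ i / exp s)) \<longlongrightarrow> (\<Sum>i\<le>degree p. coeff p i * 0)) at_top"
    by (intro tendsto_intros tendsto_power_div_exp_0)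
  then show ?thesis
    by (simp add: poly_altdef sum_distrib_right exp_minus divide_inverse mult.assoc)
qed

text \<open>At the origin the difference quotient is again a polynomial in \<open>1 / t\<close> times \<open>exp (- 1 / t)\<close>,
  and the exponential wins.\<close>

lemma flat_exp_has_derivative:
  "(flat_exp p has_real_derivative flat_exp (pCons 0 (pCons 0 (p - pderiv p))) t) (at t)"
proof -
  consider "t > 0" | "t < 0" | "t = 0" by linarith
  then show ?thesis
  proof cases
    case 1
    have "((\<lambda>t. poly p (1 / t) * exp (- 1 / t)) has_real_derivative
        flat_exp (pCons 0 (pCons 0 (p - pderiv p))) t) (at t)"
      using 1 by (auto intro!: derivative_eq_intros simp: flat_exp_def field_simps power2_eq_square)
    then show ?thesis
      by (rule has_field_derivative_transform_within_open[of _ _ _ "{0<..}"]) (use 1 in \<open>auto simp: flat_exp_def\<close>)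
  next
    case 2
    have "((\<lambda>t. 0) has_real_derivative 0) (at t)" by simp
    then have "(flat_exp p has_real_derivative 0) (at t)"
      by (rule has_field_derivative_transform_within_open[of _ _ _ "{..<0}"]) (use 2 in \<open>auto simp: flat_exp_def\<close>)
    then show ?thesis using 2 by (simp add: flat_exp_def)
  next
    case 3
    have "((\<lambda>h. poly (pCons 0 p) (inverse h) * exp (- inverse h)) \<longlongrightarrow> 0) (at_right (0::real))"
      by (rule filterlim_compose[OF poly_times_exp_tendsto_0 filterlim_inverse_at_top_right])
    then have "((\<lambda>h. (flat_exp p (0 + h) - flat_exp p 0) / h) \<longlongrightarrow> 0) (at_right 0)"
      by (rule Lim_transform_eventually)
        (auto simp: flat_exp_def eventually_at_filter field_simps intro!: always_eventually)
    moreover have "((\<lambda>h. (flat_exp p (0 + h) - flat_exp p 0) / h) \<longlongrightarrow> 0) (at_left 0)"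
      by (rule Lim_transform_eventually[OF tendsto_const])
        (auto simp: flat_exp_def eventually_at_filter intro!: always_eventually)
    ultimately have "((\<lambda>h. (flat_exp p (0 + h) - flat_exp p 0) / h) \<longlongrightarrow> 0) (at 0)"
      by (simp add: filterlim_at_split)
    then show ?thesis using 3
      by (simp add: DERIV_def flat_exp_def[of "pCons 0 (pCons 0 (p - pderiv p))"])
  qed
qed

lemma C_class_flat_exp_coordinate: "C_class m (\<lambda>x::real^'d::finite. flat_exp 1 (c * x $ j + d))"
proof -
  define P where "P = (\<lambda>n. ((\<lambda>p::real poly. pCons 0 (pCons 0 (p - pderiv p))) ^^ n) 1)"
  have "C_class m (\<lambda>x::real^'d. flat_exp (P 0) (c * x $ j + d))"
    by (rule C_class_affine_coordinate[of "\<lambda>n. flat_exp (P n)"])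
      (auto simp: P_def flat_exp_has_derivative)
  then show ?thesis by (simp add: P_def)
qed

text \<open>The dilation by \<open>n + 1\<close> leaves the support unchanged, the closed box, but steepens the flanks:
  \<open>exp (- 1 / (n t))\<close> tends to \<open>1\<close> for every \<open>t > 0\<close>. The bumps therefore converge to the
  indicator of the open box while staying between \<open>0\<close> and \<open>1\<close>.\<close>

definition box_bump :: "real^'d::finite \<Rightarrow> real^'d \<Rightarrow> nat \<Rightarrow> real^'d \<Rightarrow> real" where
  "box_bump a b n x = (\<Prod>i\<in>UNIV.
     flat_exp 1 (real (Suc n) * (x $ i - a $ i)) * flat_exp 1 (real (Suc n) * (b $ i - x $ i)))"

lemma flat_exp_1_nonzero_iff: "flat_exp 1 t \<noteq> 0 \<longleftrightarrow> t > 0"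
  by (auto simp: flat_exp_def)

lemma flat_exp_1_bounds: "0 \<le> flat_exp 1 t" "flat_exp 1 t \<le> 1"
  by (auto simp: flat_exp_def)

lemma box_bump_nonzero_iff: "box_bump a b n x \<noteq> 0 \<longleftrightarrow> x \<in> box a b"
proof -
  have "flat_exp 1 (real (Suc n) * t) = 0 \<longleftrightarrow> \<not> t > 0" for t
    using flat_exp_1_nonzero_iff[of "real (Suc n) * t"] by (auto simp: zero_less_mult_iff)
  then show ?thesis
    by (simp add: box_bump_def prod_zero_iff mem_box_cart del: of_nat_Suc)
qed

lemma box_bump_bounds: "0 \<le> box_bump a b n x" "box_bump a b n x \<le> 1"
  unfolding box_bump_def
  by (auto intro!: prod_nonneg prod_le_1 mult_le_one simp: flat_exp_1_bounds)

lemma box_bump_test_function: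
  assumes "cbox a b \<subseteq> \<Omega>"
  shows "box_bump a b n \<in> test_functions \<Omega>"
proof -
  have eq: "box_bump a b n = (\<lambda>x. \<Prod>i\<in>UNIV. flat_exp 1 (real (Suc n) * x $ i + (- real (Suc n) * a $ i))
      * flat_exp 1 (- real (Suc n) * x $ i + real (Suc n) * b $ i))"
    by (rule ext) (simp add: box_bump_def algebra_simps)
  have "C_class m (box_bump a b n)" for m
    unfolding eq by (intro C_class_prod C_class_mult C_class_flat_exp_coordinate) auto
  moreover have "closure {x. box_bump a b n x \<noteq> 0} \<subseteq> cbox a b"
    unfolding box_bump_nonzero_iff by (intro closure_minimal) (auto intro: box_subset_cbox[THEN subsetD])
  moreover from this have "compact (closure {x. box_bump a b n x \<noteq> 0})"
    using bounded_subset[OF bounded_cbox] by (metis closed_closure compact_eq_bounded_closed)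
  ultimately show ?thesis using assms by (auto simp: test_functions_def)
qed

lemma flat_exp_dilation_tendsto:
  assumes "t > 0" shows "(\<lambda>n. flat_exp 1 (real (Suc n) * t)) \<longlonglongrightarrow> 1"
proof -
  have "(\<lambda>n. exp (- (inverse (real (Suc n)) * (1 / t)))) \<longlonglongrightarrow> exp (- (0 * (1 / t)))"
    by (intro tendsto_intros LIMSEQ_inverse_real_of_nat)
  then show ?thesis using assms by (simp add: flat_exp_def field_simps del: of_nat_Suc)
qed

lemma box_bump_tendsto_indicator: "(\<lambda>n. box_bump a b n x) \<longlonglongrightarrow> indicator (box a b) x"
proof (cases "x \<in> box a b")
  case True
  then have "(\<lambda>n. box_bump a b n x) \<longlonglongrightarrow> (\<Prod>i\<in>(UNIV::'a set). 1 * 1)"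
    unfolding box_bump_def by (intro tendsto_intros flat_exp_dilation_tendsto) (auto simp: mem_box_cart)
  then show ?thesis using True by simp
next
  case False
  then have "box_bump a b n x = 0" for n using box_bump_nonzero_iff by blast
  then show ?thesis using False by simp
qed

section \<open>The fundamental lemma of the calculus of variations\<close>

text \<open>Dominated convergence along the bumps, with \<open>\<bar>f\<bar>\<close> as majorant, turns vanishing against test
  functions into vanishing over boxes.\<close>

lemma integral_box_zero_of_test_functions:
  fixes f :: "real^'d::finite \<Rightarrow> real"
  assumes f: "integrable (lebesgue_on \<Omega>) f"
    and zero: "\<And>\<phi>. \<phi> \<in> test_functions \<Omega> \<Longrightarrow> (LINT x|lebesgue_on \<Omega>. f x * \<phi> x) = 0"
    and "\<Omega> \<in> sets lebesgue" "cbox a b \<subseteq> \<Omega>"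
  shows "(LINT x|lebesgue_on \<Omega>. f x * indicator (box a b) x) = 0"
proof -
  have fm: "f \<in> borel_measurable (lebesgue_on \<Omega>)" using f by auto
  have test: "box_bump a b n \<in> test_functions \<Omega>" for n
    using assms(4) by (rule box_bump_test_function)
  have cont: "continuous_on UNIV (box_bump a b n)" for n
    using test[of n] C_class_continuous by (auto simp: test_functions_def)
  have bm: "box_bump a b n \<in> borel_measurable (lebesgue_on \<Omega>)" for n
    by (rule continuous_imp_measurable_on_sets_lebesgue[OF continuous_on_subset[OF cont] assms(3)]) simp
  have "(\<lambda>n. LINT x|lebesgue_on \<Omega>. f x * box_bump a b n x) \<longlonglongrightarrow>
      (LINT x|lebesgue_on \<Omega>. f x * indicator (box a b) x)"
  proof (rule integral_dominated_convergence[where w="\<lambda>x. norm (f x)"])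
    have "(\<lambda>x. indicator (box a b) x :: real) \<in> borel_measurable (lebesgue_on \<Omega>)"
      using assms(3,4) box_subset_cbox[of a b]
      by (intro borel_measurable_indicator) (auto simp: sets_restrict_space_iff)
    then show "(\<lambda>x. f x * indicator (box a b) x) \<in> borel_measurable (lebesgue_on \<Omega>)"
      using fm by measurable
    show "(\<lambda>x. f x * box_bump a b n x) \<in> borel_measurable (lebesgue_on \<Omega>)" for n
      using fm bm by measurable
    show "AE x in lebesgue_on \<Omega>. (\<lambda>n. f x * box_bump a b n x) \<longlonglongrightarrow> f x * indicator (box a b) x"
      by (intro AE_I2 tendsto_intros box_bump_tendsto_indicator)
    show "AE x in lebesgue_on \<Omega>. norm (f x * box_bump a b n x) \<le> norm (f x)" for n
      using box_bump_bounds[of a b n] by (intro AE_I2) (simp add: abs_mult mult_left_le)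
  qed (use f in auto)
  moreover have "(LINT x|lebesgue_on \<Omega>. f x * box_bump a b n x) = 0" for n
    by (rule zero[OF test])
  ultimately show ?thesis by (simp add: LIMSEQ_const_iff)
qed

text \<open>Boxes are an intersection-stable generator of the Borel sets, so a Dynkin argument extends the
  vanishing integrals from boxes to all Borel sets; a density with this property is null. Cutting off with
  a fixed open box first keeps every set of the argument inside the region where the hypothesis speaks.\<close>

lemma AE_zero_of_box_integrals:
  fixes f :: "'a::euclidean_space \<Rightarrow> real"
  assumes f: "integrable lborel f"
    and zero: "\<And>c d. cbox c d \<subseteq> cbox a b \<Longrightarrow> (LINT x:box c d|lborel. f x) = 0"
  shows "AE x in lborel. x \<in> box a b \<longrightarrow> f x = 0"
proof -
  define h where "h x = indicator (box a b) x *\<^sub>R f x" for x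
  have h: "integrable lborel h"
    unfolding h_def by (intro integrable_mult_indicator f) auto
  have h_on: "set_integrable lborel A h" if "A \<in> sets borel" for A
    unfolding set_integrable_def using that by (intro integrable_mult_indicator h) auto
  have sub: "(LINT x:box c d|lborel. f x) = 0" if "box c d \<subseteq> box a b" for c d
  proof (cases "box c d = {}")
    case False
    then have "cbox c d = closure (box c d)" by (simp add: closure_box)
    also have "\<dots> \<subseteq> cbox a b"
      using that box_subset_cbox[of a b] by (intro closure_minimal) auto
    finally show ?thesis by (rule zero)
  qed (simp add: set_lebesgue_integral_def)
  have box: "(LINT x:box c d|lborel. h x) = 0" for c d
  proof -
    obtain c' d' where eq: "box c d \<inter> box a b = box c' d'" using box_Int_box by blast
    have "indicator (box c d) x *\<^sub>R h x = indicator (box c' d') x *\<^sub>R f x" for x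
      unfolding h_def eq[symmetric] by (auto simp: indicator_def)
    moreover have "box c' d' \<subseteq> box a b" using eq by blast
    ultimately show ?thesis
      using sub[of c' d'] unfolding set_lebesgue_integral_def by (simp only:)
  qed
  have total: "(LINT x|lborel. h x) = 0"
  proof -
    have "indicator (box a b) x *\<^sub>R h x = h x" for x by (auto simp: h_def indicator_def)
    then show ?thesis using box[of a b] unfolding set_lebesgue_integral_def by (simp only:)
  qed
  have Borel: "(LINT x:A|lborel. h x) = 0" if A: "A \<in> sets borel" for A
  proof -
    have "Int_stable (range (\<lambda>(a, b). box a b :: 'a set))"
      by (auto simp: Int_stable_def box_Int_box)
    moreover have "range (\<lambda>(a, b). box a b :: 'a set) \<subseteq> Pow UNIV" by auto
    moreover have "A \<in> sigma_sets UNIV (range (\<lambda>(a, b). box a b))"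
      using A unfolding borel_eq_box by simp
    ultimately show ?thesis
    proof (induction rule: sigma_sets_induct_disjoint)
      case (basic A) then show ?case by (auto simp: box)
    next
      case empty then show ?case by (simp add: set_lebesgue_integral_def)
    next
      case (compl A)
      then have A: "A \<in> sets borel" by (simp add: borel_eq_box)
      have "(LINT x:A \<union> (UNIV - A)|lborel. h x) = (LINT x:A|lborel. h x) + (LINT x:UNIV - A|lborel. h x)"
        using A by (intro set_integral_Un h_on) auto
      moreover have "A \<union> (UNIV - A) = UNIV" by blast
      ultimately have "(LINT x:UNIV|lborel. h x) = (LINT x:UNIV - A|lborel. h x)"
        using compl(2) by simp
      then show ?case using total by (simp add: set_lebesgue_integral_def)
    next
      case (union F)
      then have F: "F i \<in> sets borel" for i by (simp add: borel_eq_box subset_eq)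
      have "(LINT x:\<Union>(range F)|lborel. h x) = (\<Sum>i. (LINT x:F i|lborel. h x))"
      proof (rule lebesgue_integral_countable_add)
        show "F i \<inter> F j = {}" if "i \<noteq> j" for i j
          using union(1) that unfolding disjoint_family_on_def by blast
        show "set_integrable lborel (\<Union>(range F)) h" using F by (intro h_on) auto
      qed (simp add: F)
      then show ?case by (simp add: union.IH)
    qed
  qed
  have "AE x in lborel. h x = 0"
    by (rule sigma_finite_measure.density_zero[OF lborel.sigma_finite_measure_axioms h]) (use Borel in auto)
  then show ?thesis by eventually_elim (auto simp: h_def)
qed

text \<open>The Dynkin argument is run for a Borel representative on the whole space, so the proof passes from
  \<open>f\<close> on \<open>\<Omega>\<close> to its extension by zero, and from there to a Borel function equal to it almost everywhere.
  Countably many closed boxes, whose boundaries are null sets, then exhaust \<open>\<Omega>\<close>.\<close>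

lemma fundamental_lemma_calculus_of_variations:
  fixes f :: "real^'d::finite \<Rightarrow> real"
  assumes \<Omega>: "open \<Omega>" and f: "integrable (lebesgue_on \<Omega>) f"
    and zero: "\<And>\<phi>. \<phi> \<in> test_functions \<Omega> \<Longrightarrow> (LINT x|lebesgue_on \<Omega>. f x * \<phi> x) = 0"
  shows "AE x in lebesgue_on \<Omega>. f x = 0"
proof -
  have \<Omega>_sets: "\<Omega> \<in> sets lebesgue" using \<Omega> by auto
  define f0 where "f0 x = indicator \<Omega> x *\<^sub>R f x" for x
  have f0: "integrable lebesgue f0"
    using f \<Omega>_sets by (simp add: integrable_restrict_space f0_def[abs_def])
  obtain f1 where f1_meas: "f1 \<in> borel_measurable lborel" and f1_ae: "AE x in lborel. f0 x = f1 x"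
    using completion_ex_borel_measurable_real[of f0 lborel] f0 by auto
  have [measurable]: "f1 \<in> borel_measurable borel" using f1_meas by simp
  have f1_leb: "f1 \<in> borel_measurable lebesgue" using f1_meas by (rule measurable_completion)
  have f1_ae': "AE x in lebesgue. f0 x = f1 x" using f1_ae by (rule AE_completion)
  have "integrable lebesgue f1"
    using integrable_cong_AE[OF _ f1_leb f1_ae'] f0 by auto
  then have f1: "integrable lborel f1" using integrable_completion[OF f1_meas] by simp
  have box: "(LINT x:box c d|lborel. f1 x) = 0" if "cbox c d \<subseteq> \<Omega>" for c d
  proof -
    have ind: "(indicator (box c d) :: _ \<Rightarrow> real) \<in> borel_measurable lebesgue"
      by (intro borel_measurable_indicator) auto
    have f0m: "f0 \<in> borel_measurable lebesgue" using f0 by auto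
    have "(LINT x:box c d|lborel. f1 x) = (LINT x|lebesgue. indicator (box c d) x *\<^sub>R f1 x)"
      unfolding set_lebesgue_integral_def
      by (intro integral_completion[symmetric]) measurable
    also have "\<dots> = (LINT x|lebesgue. indicator (box c d) x *\<^sub>R f0 x)"
      by (rule integral_cong_AE) (use f1_ae' f1_leb ind f0m in \<open>auto intro: borel_measurable_scaleR\<close>)
    also have "\<dots> = (LINT x|lebesgue. indicator \<Omega> x *\<^sub>R (f x * indicator (box c d) x))"
      by (simp add: f0_def mult.left_commute mult.commute)
    also have "\<dots> = (LINT x|lebesgue_on \<Omega>. f x * indicator (box c d) x)"
      using \<Omega>_sets by (intro integral_restrict_space[symmetric]) simp
    also have "\<dots> = 0"
      by (rule integral_box_zero_of_test_functions[OF f zero \<Omega>_sets that])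
    finally show ?thesis .
  qed
  have cbox: "AE x in lebesgue. x \<in> cbox a b \<longrightarrow> f1 x = 0" if "cbox a b \<subseteq> \<Omega>" for a b
  proof -
    have "AE x in lebesgue. x \<in> box a b \<longrightarrow> f1 x = 0"
      by (intro AE_completion AE_zero_of_box_integrals f1 box) (use that in auto)
    moreover have "AE x in lebesgue. x \<notin> cbox a b - box a b"
      using negligible_frontier_interval[of a b] AE_not_in unfolding negligible_iff_null_sets by blast
    ultimately show ?thesis by eventually_elim auto
  qed
  obtain \<D> where \<D>: "countable \<D>" "\<D> \<subseteq> Pow \<Omega>" "\<And>X. X \<in> \<D> \<Longrightarrow> \<exists>a b. X = cbox a b" "\<Union>\<D> = \<Omega>"
    using open_countable_Union_open_cbox[OF \<Omega>] by metis
  have "AE x in lebesgue. \<forall>X\<in>\<D>. x \<in> X \<longrightarrow> f1 x = 0"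
    unfolding AE_ball_countable[OF \<D>(1)]
  proof
    fix X assume "X \<in> \<D>"
    then obtain a b where "X = cbox a b" "cbox a b \<subseteq> \<Omega>" using \<D>(2,3) by blast
    then show "AE x in lebesgue. x \<in> X \<longrightarrow> f1 x = 0" using cbox by simp
  qed
  then have "AE x in lebesgue. x \<in> \<Omega> \<longrightarrow> f x = 0"
    using f1_ae' by eventually_elim (use \<D>(4) in \<open>auto simp: f0_def indicator_def\<close>)
  then show ?thesis using \<Omega>_sets by (simp add: AE_restrict_space_iff)
qed

section \<open>Weak gradients and the bilinear form\<close>

lemma L2_add:
  fixes f g :: "real^'d::finite \<Rightarrow> 'b::euclidean_space"
  assumes "f \<in> L2 \<Omega>" "g \<in> L2 \<Omega>"
  shows "(\<lambda>x. f x + g x) \<in> L2 \<Omega>"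
proof -
  have fm[measurable]: "f \<in> borel_measurable (lebesgue_on \<Omega>)" "g \<in> borel_measurable (lebesgue_on \<Omega>)"
    using assms by (auto simp: L2_def)
  have "integrable (lebesgue_on \<Omega>) (\<lambda>x. 2 * (norm (f x))\<^sup>2 + 2 * (norm (g x))\<^sup>2)"
    using assms by (auto simp: L2_def)
  then have "integrable (lebesgue_on \<Omega>) (\<lambda>x. (norm (f x + g x))\<^sup>2)"
  proof (rule Bochner_Integration.integrable_bound)
    have "(norm (f x + g x))\<^sup>2 \<le> 2 * (norm (f x))\<^sup>2 + 2 * (norm (g x))\<^sup>2" for x
    proof -
      have "(norm (f x + g x))\<^sup>2 \<le> (norm (f x) + norm (g x))\<^sup>2"
        by (intro power_mono norm_triangle_ineq norm_ge_zero)
      also have "\<dots> \<le> 2 * (norm (f x))\<^sup>2 + 2 * (norm (g x))\<^sup>2"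
        using sum_squares_bound[of "norm (f x)" "norm (g x)"] by (simp add: power2_sum)
      finally show ?thesis .
    qed
    then show "AE x in lebesgue_on \<Omega>. norm ((norm (f x + g x))\<^sup>2) \<le> norm (2 * (norm (f x))\<^sup>2 + 2 * (norm (g x))\<^sup>2)"
      by (intro AE_I2) simp
  qed measurable
  then show ?thesis by (simp add: L2_def)
qed

lemma L2_scaleR:
  fixes f :: "real^'d::finite \<Rightarrow> 'b::euclidean_space"
  assumes "f \<in> L2 \<Omega>" shows "(\<lambda>x. c *\<^sub>R f x) \<in> L2 \<Omega>"
  using assms by (auto simp: L2_def power_mult_distrib)

lemma L2_inner_integrable:
  fixes f g :: "real^'d::finite \<Rightarrow> 'b::euclidean_space"
  assumes "f \<in> L2 \<Omega>" "g \<in> L2 \<Omega>"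
  shows "integrable (lebesgue_on \<Omega>) (\<lambda>x. f x \<bullet> g x)"
proof -
  have fm[measurable]: "f \<in> borel_measurable (lebesgue_on \<Omega>)" "g \<in> borel_measurable (lebesgue_on \<Omega>)"
    using assms by (auto simp: L2_def)
  have "integrable (lebesgue_on \<Omega>) (\<lambda>x. (norm (f x))\<^sup>2 + (norm (g x))\<^sup>2)"
    using assms by (auto simp: L2_def)
  then show ?thesis
  proof (rule Bochner_Integration.integrable_bound)
    have "\<bar>f x \<bullet> g x\<bar> \<le> (norm (f x))\<^sup>2 + (norm (g x))\<^sup>2" for x
      using Cauchy_Schwarz_ineq2[of "f x" "g x"] sum_squares_bound[of "norm (f x)" "norm (g x)"]
        mult_nonneg_nonneg[OF norm_ge_zero[of "f x"] norm_ge_zero[of "g x"]] by linarith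
    then show "AE x in lebesgue_on \<Omega>. norm (f x \<bullet> g x) \<le> norm ((norm (f x))\<^sup>2 + (norm (g x))\<^sup>2)"
      by (intro AE_I2) simp
  qed measurable
qed

locale bounded_open =
  fixes \<Omega> :: "(real ^ 'd::finite) set"
  assumes open_\<Omega>: "open \<Omega>" and bounded_\<Omega>: "bounded \<Omega>"
begin

lemma \<Omega>_lmeasurable: "\<Omega> \<in> lmeasurable"
  using open_\<Omega> bounded_\<Omega> by (rule lmeasurable_open[rotated])

sublocale finite_measure "lebesgue_on \<Omega>"
  using \<Omega>_lmeasurable by (rule finite_measure_lebesgue_on)

lemma continuous_on_closure_measurable:
  fixes f :: "real^'d \<Rightarrow> 'b::euclidean_space"
  assumes "continuous_on (closure \<Omega>) f"
  shows "f \<in> borel_measurable (lebesgue_on \<Omega>)"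
  using continuous_on_subset[OF assms closure_subset] open_\<Omega>
  by (intro continuous_imp_measurable_on_sets_lebesgue) auto

lemma continuous_on_closure_integrable:
  fixes f :: "real^'d \<Rightarrow> 'b::euclidean_space"
  assumes "continuous_on (closure \<Omega>) f"
  shows "integrable (lebesgue_on \<Omega>) f"
proof -
  have "compact (closure \<Omega>)" using bounded_\<Omega> by simp
  then have "bounded (f ` closure \<Omega>)" using assms compact_continuous_image compact_imp_bounded by blast
  then obtain M where "\<And>x. x \<in> closure \<Omega> \<Longrightarrow> norm (f x) \<le> M" by (auto simp: bounded_iff)
  then have "AE x in lebesgue_on \<Omega>. norm (f x) \<le> M"
    using closure_subset by (intro AE_I2) auto
  then show ?thesis
    using continuous_on_closure_measurable[OF assms] by (rule integrable_const_bound)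
qed

lemma continuous_on_closure_L2:
  fixes f :: "real^'d \<Rightarrow> 'b::euclidean_space"
  assumes "continuous_on (closure \<Omega>) f"
  shows "f \<in> L2 \<Omega>"
  using assms continuous_on_closure_measurable[OF assms]
  by (auto simp: L2_def intro!: continuous_on_closure_integrable continuous_intros)

lemma test_function_continuous:
  assumes "\<phi> \<in> test_functions \<Omega>" shows "continuous_on S \<phi>" "continuous_on S (partial i \<phi>)"
proof -
  have C1: "C_class (Suc 0) \<phi>" using assms by (simp add: test_functions_def)
  have "continuous_on UNIV \<phi>" "continuous_on UNIV (partial i \<phi>)"
    using C1 C_class_continuous[OF C1] by auto
  then show "continuous_on S \<phi>" "continuous_on S (partial i \<phi>)"
    using continuous_on_subset by blast+
qed

lemma L2_component_test_integrable:
  fixes g :: "real^'d \<Rightarrow> real^'d"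
  assumes "g \<in> L2 \<Omega>" "\<phi> \<in> test_functions \<Omega>"
  shows "integrable (lebesgue_on \<Omega>) (\<lambda>x. g x $ i * \<phi> x)"
proof -
  have "(\<lambda>x. \<phi> x *\<^sub>R axis i 1 :: real^'d) \<in> L2 \<Omega>"
    by (intro continuous_on_closure_L2 continuous_intros test_function_continuous assms)
  from L2_inner_integrable[OF assms(1) this] show ?thesis
    by (simp add: inner_axis mult.commute)
qed

lemma weak_gradient_lincomb:
  assumes v: "continuous_on (closure \<Omega>) v" "L2_weak_gradient \<Omega> v g"
    and w: "continuous_on (closure \<Omega>) w" "L2_weak_gradient \<Omega> w h"
  shows "L2_weak_gradient \<Omega> (\<lambda>x. a * v x + b * w x) (\<lambda>x. a *\<^sub>R g x + b *\<^sub>R h x)"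
  unfolding L2_weak_gradient_def
proof (intro conjI ballI allI)
  have L2: "g \<in> L2 \<Omega>" "h \<in> L2 \<Omega>" using v w by (auto simp: L2_weak_gradient_def)
  then show "(\<lambda>x. a *\<^sub>R g x + b *\<^sub>R h x) \<in> L2 \<Omega>" by (intro L2_add L2_scaleR)
  fix \<phi> :: "real^'d \<Rightarrow> real" and i assume \<phi>: "\<phi> \<in> test_functions \<Omega>"
  have int: "integrable (lebesgue_on \<Omega>) (\<lambda>x. v x * partial i \<phi> x)"
    "integrable (lebesgue_on \<Omega>) (\<lambda>x. w x * partial i \<phi> x)"
    using v w by (auto intro!: continuous_on_closure_integrable continuous_intros test_function_continuous[OF \<phi>])
  have "(LINT x|lebesgue_on \<Omega>. (a * v x + b * w x) * partial i \<phi> x) =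
      (LINT x|lebesgue_on \<Omega>. a * (v x * partial i \<phi> x) + b * (w x * partial i \<phi> x))"
    by (simp add: algebra_simps)
  also have "\<dots> = a * (LINT x|lebesgue_on \<Omega>. v x * partial i \<phi> x) + b * (LINT x|lebesgue_on \<Omega>. w x * partial i \<phi> x)"
    using int by simp
  also have "\<dots> = - (a * (LINT x|lebesgue_on \<Omega>. g x $ i * \<phi> x) + b * (LINT x|lebesgue_on \<Omega>. h x $ i * \<phi> x))"
    using v w \<phi> by (simp add: L2_weak_gradient_def)
  also have "a * (LINT x|lebesgue_on \<Omega>. g x $ i * \<phi> x) + b * (LINT x|lebesgue_on \<Omega>. h x $ i * \<phi> x)
     = (LINT x|lebesgue_on \<Omega>. a * (g x $ i * \<phi> x) + b * (h x $ i * \<phi> x))"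
    using L2_component_test_integrable[OF L2(1) \<phi>] L2_component_test_integrable[OF L2(2) \<phi>] by simp
  also have "\<dots> = (LINT x|lebesgue_on \<Omega>. (a *\<^sub>R g x + b *\<^sub>R h x) $ i * \<phi> x)"
    by (simp add: algebra_simps)
  finally show "(LINT x|lebesgue_on \<Omega>. (a * v x + b * w x) * partial i \<phi> x) =
      - (LINT x|lebesgue_on \<Omega>. (a *\<^sub>R g x + b *\<^sub>R h x) $ i * \<phi> x)" .
qed

text \<open>This makes the chosen representative behind the bilinear form irrelevant: any other weak gradient
  gives the same integrals.\<close>

lemma weak_gradient_unique:
  assumes "L2_weak_gradient \<Omega> v g" "L2_weak_gradient \<Omega> v h"
  shows "AE x in lebesgue_on \<Omega>. g x = h x"
proof -
  have L2: "g \<in> L2 \<Omega>" "h \<in> L2 \<Omega>" using assms by (auto simp: L2_weak_gradient_def)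
  have "AE x in lebesgue_on \<Omega>. g x $ i - h x $ i = 0" for i
  proof (rule fundamental_lemma_calculus_of_variations[OF open_\<Omega>])
    have "(\<lambda>x. axis i 1 :: real^'d) \<in> L2 \<Omega>" by (intro continuous_on_closure_L2 continuous_intros)
    from L2_inner_integrable[OF L2(1) this] L2_inner_integrable[OF L2(2) this]
    show "integrable (lebesgue_on \<Omega>) (\<lambda>x. g x $ i - h x $ i)"
      by (auto simp: inner_axis)
    fix \<phi> :: "real^'d \<Rightarrow> real" assume \<phi>: "\<phi> \<in> test_functions \<Omega>"
    have "(LINT x|lebesgue_on \<Omega>. (g x $ i - h x $ i) * \<phi> x) =
        (LINT x|lebesgue_on \<Omega>. g x $ i * \<phi> x - h x $ i * \<phi> x)"
      by (simp add: algebra_simps)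
    also have "\<dots> = (LINT x|lebesgue_on \<Omega>. g x $ i * \<phi> x) - (LINT x|lebesgue_on \<Omega>. h x $ i * \<phi> x)"
      using L2_component_test_integrable[OF L2(1) \<phi>] L2_component_test_integrable[OF L2(2) \<phi>] by simp
    also have "\<dots> = 0"
      using assms \<phi> unfolding L2_weak_gradient_def by (metis (no_types, lifting) diff_self neg_equal_iff_equal)
    finally show "(LINT x|lebesgue_on \<Omega>. (g x $ i - h x $ i) * \<phi> x) = 0" .
  qed
  then have "AE x in lebesgue_on \<Omega>. \<forall>i. g x $ i - h x $ i = 0"
    by (simp add: eventually_all_finite)
  then show ?thesis by eventually_elim (simp add: vec_eq_iff)
qed

lemma weak_grad: "v \<in> H1 \<Omega> \<Longrightarrow> L2_weak_gradient \<Omega> v (weak_grad \<Omega> v)"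
  unfolding H1_def weak_grad_def by (auto intro: someI[of "L2_weak_gradient \<Omega> v"])

lemma C0_H1_lincomb:
  assumes "v \<in> C0 \<Omega> \<inter> H1 \<Omega>" "w \<in> C0 \<Omega> \<inter> H1 \<Omega>"
  shows "(\<lambda>x. a * v x + b * w x) \<in> C0 \<Omega> \<inter> H1 \<Omega>"
proof -
  have *: "continuous_on (closure \<Omega>) (\<lambda>x. a * v x + b * w x)"
    using assms by (auto simp: C0_def intro!: continuous_intros)
  moreover have "L2_weak_gradient \<Omega> (\<lambda>x. a * v x + b * w x) (\<lambda>x. a *\<^sub>R weak_grad \<Omega> v x + b *\<^sub>R weak_grad \<Omega> w x)"
    using assms by (intro weak_gradient_lincomb weak_grad) (auto simp: C0_def)
  ultimately show ?thesis
    using continuous_on_closure_L2[OF *] by (auto simp: C0_def H1_def)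
qed

lemma weak_grad_L2: "v \<in> H1 \<Omega> \<Longrightarrow> weak_grad \<Omega> v \<in> L2 \<Omega>"
  using weak_grad by (auto simp: L2_weak_gradient_def)

text \<open>The chosen gradient of a combination need not be the combination of the chosen gradients pointwise,
  but both are weak gradients of the same function, so they agree almost everywhere.\<close>

lemma A_form_lincomb:
  assumes v: "v \<in> C0 \<Omega> \<inter> H1 \<Omega>" and w: "w \<in> C0 \<Omega> \<inter> H1 \<Omega>" and z: "z \<in> C0 \<Omega> \<inter> H1 \<Omega>"
  shows "A_form \<Omega> (\<lambda>_. c) (\<lambda>x. a * v x + b * w x) z = a * A_form \<Omega> (\<lambda>_. c) v z + b * A_form \<Omega> (\<lambda>_. c) w z"
proof -
  let ?s = "\<lambda>x. a * v x + b * w x"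
  have s: "?s \<in> H1 \<Omega>" using C0_H1_lincomb[OF v w] by simp
  have L2: "weak_grad \<Omega> v \<in> L2 \<Omega>" "weak_grad \<Omega> w \<in> L2 \<Omega>" "weak_grad \<Omega> z \<in> L2 \<Omega>" "weak_grad \<Omega> ?s \<in> L2 \<Omega>"
    using v w z s by (auto intro: weak_grad_L2)
  then have [measurable]: "weak_grad \<Omega> v \<in> borel_measurable (lebesgue_on \<Omega>)"
    "weak_grad \<Omega> w \<in> borel_measurable (lebesgue_on \<Omega>)" "weak_grad \<Omega> z \<in> borel_measurable (lebesgue_on \<Omega>)"
    "weak_grad \<Omega> ?s \<in> borel_measurable (lebesgue_on \<Omega>)"
    by (auto simp: L2_def)
  have "AE x in lebesgue_on \<Omega>. weak_grad \<Omega> ?s x = a *\<^sub>R weak_grad \<Omega> v x + b *\<^sub>R weak_grad \<Omega> w x"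
    using v w s by (intro weak_gradient_unique[OF weak_grad] weak_gradient_lincomb weak_grad) (auto simp: C0_def)
  then have "AE x in lebesgue_on \<Omega>. c * (weak_grad \<Omega> ?s x \<bullet> weak_grad \<Omega> z x) =
      a * (c * (weak_grad \<Omega> v x \<bullet> weak_grad \<Omega> z x)) + b * (c * (weak_grad \<Omega> w x \<bullet> weak_grad \<Omega> z x))"
    by eventually_elim (simp add: algebra_simps inner_add_left)
  then have "A_form \<Omega> (\<lambda>_. c) ?s z = (LINT x|lebesgue_on \<Omega>.
      a * (c * (weak_grad \<Omega> v x \<bullet> weak_grad \<Omega> z x)) + b * (c * (weak_grad \<Omega> w x \<bullet> weak_grad \<Omega> z x)))"
    unfolding A_form_def by (intro integral_cong_AE) measurable
  then show ?thesis
    using L2_inner_integrable[OF L2(1,3)] L2_inner_integrable[OF L2(2,3)] by (simp add: A_form_def)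
qed

lemma A_form_commute: "A_form \<Omega> a v w = A_form \<Omega> a w v"
  by (simp add: A_form_def inner_commute)

lemma A_form_nonneg: "c \<ge> 0 \<Longrightarrow> A_form \<Omega> (\<lambda>_. c) v v \<ge> 0"
  by (simp add: A_form_def)

text \<open>A nonzero value at a point of \<open>\<Omega>\<close> would persist on a nonempty open set, which is not null;
  from \<open>\<Omega>\<close> to its closure the value passes by continuity.\<close>

lemma continuous_square_integral_zero:
  fixes v :: "real^'d \<Rightarrow> real"
  assumes v: "continuous_on (closure \<Omega>) v" and zero: "(LINT x|lebesgue_on \<Omega>. (v x)\<^sup>2) = 0"
    and x: "x \<in> closure \<Omega>"
  shows "v x = 0"
proof -
  have "integrable (lebesgue_on \<Omega>) (\<lambda>x. (v x)\<^sup>2)"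
    using v by (auto intro!: continuous_on_closure_integrable continuous_intros)
  then have "AE x in lebesgue_on \<Omega>. (v x)\<^sup>2 = 0"
    using zero by (subst (asm) integral_nonneg_eq_0_iff_AE) auto
  then have ae: "AE x in lebesgue. x \<in> \<Omega> \<longrightarrow> v x = 0"
    using \<Omega>_lmeasurable by (simp add: AE_restrict_space_iff fmeasurableD)
  have "v x = 0" if "x \<in> \<Omega>" for x
  proof (rule ccontr)
    assume "v x \<noteq> 0"
    define S where "S = \<Omega> \<inter> v -` (- {0})"
    have "open S"
      unfolding S_def using continuous_on_subset[OF v closure_subset] open_\<Omega>
      by (intro continuous_open_preimage) auto
    moreover have "x \<in> S" using that \<open>v x \<noteq> 0\<close> by (simp add: S_def)
    moreover have "AE x in lebesgue. x \<notin> S"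
      using ae by eventually_elim (auto simp: S_def)
    then have "negligible S"
      using \<open>open S\<close> by (simp add: negligible_iff_null_sets AE_iff_null_sets)
    ultimately show False using open_not_negligible by blast
  qed
  then show ?thesis
    using continuous_constant_on_closure[OF v _ x] by blast
qed

end

section \<open>Finite-dimensional variational problems and the finite element space\<close>

text \<open>Functions matter only through their values on \<open>X\<close>, hence the two hypotheses on functions that vanish
  on \<open>X\<close>. The induction is on the number of generators. Dropping one generator leaves a subspace \<open>V0\<close> of
  codimension at most one. Solving on \<open>V0\<close>, once for \<open>L\<close> and once for \<open>a w\<close> with some \<open>w\<close> outside
  \<open>V0\<close>, yields \<open>u0\<close> and a vector \<open>w' = w - z\<close> that is orthogonal to \<open>V0\<close>; the solution on \<open>V\<close> is
  \<open>u0 + (L w' / a w' w') w'\<close>. Arguing with generators rather than a basis avoids any question of linear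
  independence.\<close>

lemma finite_dimensional_riesz:
  fixes V :: "('a \<Rightarrow> real) set" and b :: "'j \<Rightarrow> 'a \<Rightarrow> real"
    and a :: "('a \<Rightarrow> real) \<Rightarrow> ('a \<Rightarrow> real) \<Rightarrow> real" and L :: "('a \<Rightarrow> real) \<Rightarrow> real"
  assumes "finite J"
    and "(\<lambda>_. 0) \<in> V"
    and "\<And>v w s t. v \<in> V \<Longrightarrow> w \<in> V \<Longrightarrow> (\<lambda>x. s * v x + t * w x) \<in> V"
    and "\<And>v. v \<in> V \<Longrightarrow> \<exists>c. \<forall>x\<in>X. v x = (\<Sum>j\<in>J. c j * b j x)"
    and "\<And>v w. v \<in> V \<Longrightarrow> w \<in> V \<Longrightarrow> a v w = a w v"
    and "\<And>v w z s t. v \<in> V \<Longrightarrow> w \<in> V \<Longrightarrow> z \<in> V \<Longrightarrow>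
      a (\<lambda>x. s * v x + t * w x) z = s * a v z + t * a w z"
    and "\<And>v x. v \<in> V \<Longrightarrow> x \<in> X \<Longrightarrow> v x \<noteq> 0 \<Longrightarrow> a v v > 0"
    and "\<And>v w. v \<in> V \<Longrightarrow> w \<in> V \<Longrightarrow> (\<And>x. x \<in> X \<Longrightarrow> v x = 0) \<Longrightarrow> a v w = 0"
    and "\<And>v w s t. v \<in> V \<Longrightarrow> w \<in> V \<Longrightarrow> L (\<lambda>x. s * v x + t * w x) = s * L v + t * L w"
    and "\<And>v. v \<in> V \<Longrightarrow> (\<And>x. x \<in> X \<Longrightarrow> v x = 0) \<Longrightarrow> L v = 0"
  shows "\<exists>u\<in>V. \<forall>\<phi>\<in>V. a u \<phi> = L \<phi>"
  using assms
proof (induction J arbitrary: V L rule: finite_induct)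
  case empty
  have "a (\<lambda>_. 0) \<phi> = L \<phi>" if "\<phi> \<in> V" for \<phi>
  proof -
    have "\<And>x. x \<in> X \<Longrightarrow> \<phi> x = 0" using empty(3)[OF that] by simp
    then have "L \<phi> = 0" by (intro empty(9) that)
    moreover have "a (\<lambda>_. 0) \<phi> = 0" by (rule empty(7)) (use empty(1) that in auto)
    ultimately show ?thesis by simp
  qed
  then show ?case using empty(1) by blast
next
  case (insert j J V L)
  note V_zero = insert.prems(1) and V_lin = insert.prems(2) and V_span = insert.prems(3)
    and a_sym = insert.prems(4) and a_lin = insert.prems(5) and a_pos = insert.prems(6)
    and a_cong = insert.prems(7) and L_lin = insert.prems(8) and L_cong = insert.prems(9)
  have a_lin_right: "a z (\<lambda>x. s * v x + t * w x) = s * a z v + t * a z w"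
    if "v \<in> V" "w \<in> V" "z \<in> V" for v w z s t
    using a_lin[OF that, of s t] a_sym[OF that(3)] V_lin[OF that(1,2)] that by metis
  define V0 where "V0 = {v \<in> V. \<exists>c. \<forall>x\<in>X. v x = (\<Sum>i\<in>J. c i * b i x)}"
  have V0_V: "v \<in> V" if "v \<in> V0" for v using that by (simp add: V0_def)
  have V0_span: "\<exists>c. \<forall>x\<in>X. v x = (\<Sum>i\<in>J. c i * b i x)" if "v \<in> V0" for v
    using that by (simp add: V0_def)
  have V0_lin: "(\<lambda>x. s * v x + t * w x) \<in> V0" if v: "v \<in> V0" and w: "w \<in> V0" for v w s t
  proof -
    obtain c d where "\<forall>x\<in>X. v x = (\<Sum>i\<in>J. c i * b i x)" "\<forall>x\<in>X. w x = (\<Sum>i\<in>J. d i * b i x)"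
      using V0_span v w by blast
    moreover define e where "e = (\<lambda>i. s * c i + t * d i)"
    ultimately have "\<forall>x\<in>X. s * v x + t * w x = (\<Sum>i\<in>J. e i * b i x)"
      by (simp add: e_def sum_distrib_left sum.distrib distrib_right mult.assoc)
    then have "\<exists>e. \<forall>x\<in>X. s * v x + t * w x = (\<Sum>i\<in>J. e i * b i x)" by blast
    moreover have "(\<lambda>x. s * v x + t * w x) \<in> V"
      using v w by (intro V_lin V0_V)
    ultimately show ?thesis unfolding V0_def by blast
  qed
  have V0_zero: "(\<lambda>_. 0) \<in> V0"
    unfolding V0_def mem_Collect_eq
    by (rule conjI[OF V_zero], rule exI[of _ "\<lambda>_. 0"]) simp
  have IH: "\<exists>u\<in>V0. \<forall>\<phi>\<in>V0. a u \<phi> = L' \<phi>"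
    if "\<And>v w s t. v \<in> V0 \<Longrightarrow> w \<in> V0 \<Longrightarrow> L' (\<lambda>x. s * v x + t * w x) = s * L' v + t * L' w"
      and "\<And>v. v \<in> V0 \<Longrightarrow> (\<And>x. x \<in> X \<Longrightarrow> v x = 0) \<Longrightarrow> L' v = 0" for L'
  proof (rule insert.IH[OF V0_zero V0_lin V0_span])
    show "a v w = a w v" if "v \<in> V0" "w \<in> V0" for v w
      using a_sym V0_V that by blast
    show "a (\<lambda>x. s * v x + t * w x) z = s * a v z + t * a w z"
      if "v \<in> V0" "w \<in> V0" "z \<in> V0" for v w z s t
      using a_lin V0_V that by blast
    show "a v v > 0" if "v \<in> V0" "x \<in> X" "v x \<noteq> 0" for v x
      using a_pos V0_V that by blast
    show "a v w = 0" if "v \<in> V0" "w \<in> V0" "\<And>x. x \<in> X \<Longrightarrow> v x = 0" for v w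
      using a_cong V0_V that by blast
  qed (assumption | rule that; assumption)+
  obtain u0 where u0: "u0 \<in> V0" "\<And>\<phi>. \<phi> \<in> V0 \<Longrightarrow> a u0 \<phi> = L \<phi>"
    using IH[of L] L_lin L_cong V0_V by blast
  show ?case
  proof (cases "V \<subseteq> V0")
    case True
    then show ?thesis using u0 V0_V by blast
  next
    case False
    then obtain w where w: "w \<in> V" "w \<notin> V0" by blast
    have "\<exists>z\<in>V0. \<forall>\<phi>\<in>V0. a z \<phi> = a w \<phi>"
    proof (rule IH)
      show "a w (\<lambda>x. s * v x + t * v' x) = s * a w v + t * a w v'" if "v \<in> V0" "v' \<in> V0" for v v' s t
        using a_lin_right w that V0_V by blast
      show "a w v = 0" if "v \<in> V0" "\<And>x. x \<in> X \<Longrightarrow> v x = 0" for v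
        using a_cong[OF V0_V w(1)] a_sym[OF V0_V w(1)] that by metis
    qed
    then obtain z where z: "z \<in> V0" "\<And>\<phi>. \<phi> \<in> V0 \<Longrightarrow> a z \<phi> = a w \<phi>" by blast
    define w' where "w' = (\<lambda>x. 1 * w x + (-1) * z x)"
    have w': "w' \<in> V" unfolding w'_def using V_lin w(1) V0_V[OF z(1)] by blast
    have orth: "a w' \<phi> = 0" if "\<phi> \<in> V0" for \<phi>
      using a_lin[OF w(1) V0_V[OF z(1)] V0_V[OF that], of 1 "-1"] z(2)[OF that] by (simp add: w'_def)
    obtain cz where cz: "\<forall>x\<in>X. z x = (\<Sum>i\<in>J. cz i * b i x)" using V0_span z(1) by blast
    have "\<exists>x\<in>X. w' x \<noteq> 0"
    proof (rule ccontr)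
      assume "\<not> (\<exists>x\<in>X. w' x \<noteq> 0)"
      then have "\<forall>x\<in>X. w x = (\<Sum>i\<in>J. cz i * b i x)" using cz by (simp add: w'_def)
      then show False using w by (auto simp: V0_def)
    qed
    then have pos: "a w' w' > 0" using a_pos[OF w'] by blast
    obtain cw where cw: "\<forall>x\<in>X. w x = (\<Sum>i\<in>insert j J. cw i * b i x)" using V_span w(1) by blast
    have "cw j \<noteq> 0"
    proof
      assume "cw j = 0"
      then have "\<forall>x\<in>X. w x = (\<Sum>i\<in>J. cw i * b i x)" using cw insert.hyps by simp
      then show False using w by (auto simp: V0_def)
    qed
    define t where "t = L w' / a w' w'"
    define u where "u = (\<lambda>x. 1 * u0 x + t * w' x)"
    have u: "u \<in> V" unfolding u_def using V_lin V0_V[OF u0(1)] w' by blast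
    have "a u v = L v" if v: "v \<in> V" for v
    proof -
      obtain cv where cv: "\<forall>x\<in>X. v x = (\<Sum>i\<in>insert j J. cv i * b i x)" using V_span v by blast
      define r where "r = cv j / cw j"
      \<comment> \<open>The generator \<open>b j\<close> occurs in \<open>w'\<close> with the coefficient \<open>cw j\<close>, because \<open>z\<close> does without it;
        this multiple of \<open>w'\<close> cancels it from \<open>v\<close>.\<close>
      define v0 where "v0 = (\<lambda>x. 1 * v x + (- r) * w' x)"
      have v0_V: "v0 \<in> V" unfolding v0_def using V_lin v w' by blast
      define d where "d = (\<lambda>i. cv i - r * cw i + r * cz i)"
      have "\<forall>x\<in>X. v0 x = (\<Sum>i\<in>J. d i * b i x)"
      proof
        fix x assume "x \<in> X"
        then have "v0 x = (cv j - r * cw j) * b j x + ((\<Sum>i\<in>J. cv i * b i x) - r * (\<Sum>i\<in>J. cw i * b i x) + r * (\<Sum>i\<in>J. cz i * b i x))"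
          using cv cw cz insert.hyps by (simp add: v0_def w'_def algebra_simps)
        also have "cv j - r * cw j = 0" using \<open>cw j \<noteq> 0\<close> by (simp add: r_def)
        also have "(\<Sum>i\<in>J. cv i * b i x) - r * (\<Sum>i\<in>J. cw i * b i x) + r * (\<Sum>i\<in>J. cz i * b i x) = (\<Sum>i\<in>J. d i * b i x)"
          unfolding sum_distrib_left sum.distrib[symmetric] sum_subtractf[symmetric] d_def
          by (intro sum.cong refl) (simp add: algebra_simps)
        finally show "v0 x = (\<Sum>i\<in>J. d i * b i x)" by simp
      qed
      then have "\<exists>c. \<forall>x\<in>X. v0 x = (\<Sum>i\<in>J. c i * b i x)" by blast
      then have v0: "v0 \<in> V0" using v0_V by (simp add: V0_def)
      have v_eq: "v = (\<lambda>x. 1 * v0 x + r * w' x)" by (simp add: v0_def)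
      have "a u v0 = L v0"
        using a_lin[OF V0_V[OF u0(1)] w' v0_V, of 1 t] u0(2)[OF v0] orth[OF v0] by (simp add: u_def)
      moreover have "a u w' = L w'"
        using a_lin[OF V0_V[OF u0(1)] w' w', of 1 t] orth[OF u0(1)] a_sym[OF V0_V[OF u0(1)] w'] pos
        by (simp add: u_def t_def)
      ultimately have "1 * a u v0 + r * a u w' = 1 * L v0 + r * L w'" by simp
      then show "a u v = L v"
        using a_lin_right[OF v0_V w' u, of 1 r] L_lin[OF v0_V w', of 1 r] by (simp only: v_eq[symmetric])
    qed
    then show ?thesis using u by blast
  qed
qed

lemma finite_multi_indices: "finite {\<alpha> :: 'd::finite \<Rightarrow> nat. (\<Sum>i\<in>UNIV. \<alpha> i) \<le> k}"
proof (rule finite_subset)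
  show "finite (PiE UNIV (\<lambda>_::'d. {..k}))" by (rule finite_PiE) auto
  have "\<alpha> i \<le> k" if "(\<Sum>i\<in>UNIV. \<alpha> i) \<le> k" for \<alpha> :: "'d \<Rightarrow> nat" and i
    using member_le_sum[of i UNIV \<alpha>] that by simp
  then show "{\<alpha> :: 'd \<Rightarrow> nat. (\<Sum>i\<in>UNIV. \<alpha> i) \<le> k} \<subseteq> PiE UNIV (\<lambda>_. {..k})"
    by auto
qed

lemma poly_space_lincomb:
  assumes "p \<in> poly_space k" "q \<in> poly_space k"
  shows "(\<lambda>x. s * p x + t * q x) \<in> poly_space k"
proof -
  obtain c d where "p = (\<lambda>x. \<Sum>\<alpha> | (\<Sum>i\<in>UNIV. \<alpha> i) \<le> k. c \<alpha> * (\<Prod>i\<in>UNIV. (x $ i) ^ \<alpha> i))"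
    "q = (\<lambda>x. \<Sum>\<alpha> | (\<Sum>i\<in>UNIV. \<alpha> i) \<le> k. d \<alpha> * (\<Prod>i\<in>UNIV. (x $ i) ^ \<alpha> i))"
    using assms unfolding poly_space_def by blast
  then have "(\<lambda>x. s * p x + t * q x) =
      (\<lambda>x. \<Sum>\<alpha> | (\<Sum>i\<in>UNIV. \<alpha> i) \<le> k. (s * c \<alpha> + t * d \<alpha>) * (\<Prod>i\<in>UNIV. (x $ i) ^ \<alpha> i))"
    by (simp add: sum_distrib_left sum.distrib algebra_simps)
  then show ?thesis
    unfolding poly_space_def by (intro CollectI exI[of _ "\<lambda>\<alpha>. s * c \<alpha> + t * d \<alpha>"])
qed

text \<open>The generators are the monomials cut off to single elements. Neighbouring elements share boundary
  points, so each point is first assigned to one element containing it.\<close>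

lemma fe_space_finite_generators:
  fixes \<Omega> :: "(real^'d::finite) set"
  assumes "finite \<T>" "closure \<Omega> \<subseteq> \<Union>\<T>"
  shows "\<exists>J (b :: (real^'d) set \<times> ('d \<Rightarrow> nat) \<Rightarrow> real^'d \<Rightarrow> real). finite J \<and>
    (\<forall>v\<in>fe_space \<Omega> \<T> k. \<exists>c. \<forall>x\<in>closure \<Omega>. v x = (\<Sum>j\<in>J. c j * b j x))"
proof -
  let ?M = "{\<alpha> :: 'd \<Rightarrow> nat. (\<Sum>i\<in>UNIV. \<alpha> i) \<le> k}"
  define el where "el x = (SOME T. T \<in> \<T> \<and> x \<in> T)" for x
  define b where "b = (\<lambda>(T, \<alpha> :: 'd \<Rightarrow> nat) x. if el x = T then (\<Prod>i\<in>UNIV. (x $ i) ^ \<alpha> i) else (0::real))"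
  have "\<exists>c. \<forall>x\<in>closure \<Omega>. v x = (\<Sum>j\<in>\<T> \<times> ?M. c j * b j x)" if v: "v \<in> fe_space \<Omega> \<T> k" for v
  proof -
    have "\<forall>T\<in>\<T>. \<exists>c. \<forall>x\<in>T. v x = (\<Sum>\<alpha>\<in>?M. c \<alpha> * (\<Prod>i\<in>UNIV. (x $ i) ^ \<alpha> i))"
    proof
      fix T assume "T \<in> \<T>"
      then obtain p where p: "p \<in> poly_space k" "\<forall>x\<in>T. v x = p x" using v by (auto simp: fe_space_def)
      then obtain c where "p = (\<lambda>x. \<Sum>\<alpha>\<in>?M. c \<alpha> * (\<Prod>i\<in>UNIV. (x $ i) ^ \<alpha> i))"
        unfolding poly_space_def by blast
      with p(2) show "\<exists>c. \<forall>x\<in>T. v x = (\<Sum>\<alpha>\<in>?M. c \<alpha> * (\<Prod>i\<in>UNIV. (x $ i) ^ \<alpha> i))"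
        by (intro exI[of _ c]) simp
    qed
    then obtain c where c: "\<And>T x. T \<in> \<T> \<Longrightarrow> x \<in> T \<Longrightarrow> v x = (\<Sum>\<alpha>\<in>?M. c T \<alpha> * (\<Prod>i\<in>UNIV. (x $ i) ^ \<alpha> i))"
      unfolding bchoice_iff by blast
    have "v x = (\<Sum>j\<in>\<T> \<times> ?M. (case j of (T, \<alpha>) \<Rightarrow> c T \<alpha>) * b j x)" if "x \<in> closure \<Omega>" for x
    proof -
      have el: "el x \<in> \<T>" "x \<in> el x"
        using assms(2) that someI_ex[of "\<lambda>T. T \<in> \<T> \<and> x \<in> T"] by (auto simp: el_def)
      have "(\<Sum>j\<in>\<T> \<times> ?M. (case j of (T, \<alpha>) \<Rightarrow> c T \<alpha>) * b j x) =
          (\<Sum>T\<in>\<T>. \<Sum>\<alpha>\<in>?M. c T \<alpha> * b (T, \<alpha>) x)"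
        by (simp add: sum.cartesian_product case_prod_beta)
      also have "\<dots> = (\<Sum>T\<in>\<T>. if el x = T then (\<Sum>\<alpha>\<in>?M. c T \<alpha> * (\<Prod>i\<in>UNIV. (x $ i) ^ \<alpha> i)) else 0)"
        by (intro sum.cong) (auto simp: b_def)
      also have "\<dots> = v x" using assms(1) el c by simp
      finally show ?thesis by simp
    qed
    then show ?thesis by blast
  qed
  moreover have "finite (\<T> \<times> ?M)" using assms(1) finite_multi_indices by blast
  ultimately show ?thesis by (intro exI[of _ "\<T> \<times> ?M"] exI[of _ b]) blast
qed

context bounded_open
begin

lemma fe_space_lincomb:
  assumes "v \<in> fe_space \<Omega> \<T> k" "w \<in> fe_space \<Omega> \<T> k"
  shows "(\<lambda>x. s * v x + t * w x) \<in> fe_space \<Omega> \<T> k"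
proof -
  have "\<exists>p\<in>poly_space k. \<forall>x\<in>T. s * v x + t * w x = p x" if T: "T \<in> \<T>" for T
  proof -
    obtain p q where "p \<in> poly_space k" "\<forall>x\<in>T. v x = p x" "q \<in> poly_space k" "\<forall>x\<in>T. w x = q x"
      using assms T unfolding fe_space_def by blast
    then show ?thesis
      by (intro bexI[of _ "\<lambda>x. s * p x + t * q x"] poly_space_lincomb) auto
  qed
  moreover have "(\<lambda>x. s * v x + t * w x) \<in> C0 \<Omega> \<inter> H1 \<Omega>"
    using assms by (intro C0_H1_lincomb) (auto simp: fe_space_def)
  ultimately show ?thesis by (simp add: fe_space_def)
qed

text \<open>Such a function has the same weak gradients as the zero function, hence the same chosen one, and the
  bilinear form of the zero function vanishes by linearity.\<close>

lemma A_form_zero: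
  assumes "v \<in> C0 \<Omega> \<inter> H1 \<Omega>" "w \<in> C0 \<Omega> \<inter> H1 \<Omega>" and zero: "\<And>x. x \<in> \<Omega> \<Longrightarrow> v x = 0"
  shows "A_form \<Omega> (\<lambda>_. c) v w = 0"
proof -
  have "(LINT x|lebesgue_on \<Omega>. v x * partial i \<phi> x) = (LINT x|lebesgue_on \<Omega>. (0 * v x + 0 * v x) * partial i \<phi> x)"
    for \<phi> i using zero by (intro Bochner_Integration.integral_cong) auto
  then have "L2_weak_gradient \<Omega> v = L2_weak_gradient \<Omega> (\<lambda>x. 0 * v x + 0 * v x)"
    unfolding L2_weak_gradient_def by (simp only:)
  then have "weak_grad \<Omega> v = weak_grad \<Omega> (\<lambda>x. 0 * v x + 0 * v x)" by (simp only: weak_grad_def)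
  then have "A_form \<Omega> (\<lambda>_. c) v w = A_form \<Omega> (\<lambda>_. c) (\<lambda>x. 0 * v x + 0 * v x) w" by (simp only: A_form_def)
  then show ?thesis using A_form_lincomb[OF assms(1,1,2), of c 0 0] by simp
qed

end

section \<open>The scheme\<close>

text \<open>One step of the scheme over an arbitrary space of continuous functions in \<open>H1 \<Omega>\<close>. The potential
  enters only through a coefficient that is continuous on the closure.\<close>

locale scheme_step = bounded_open \<Omega> for \<Omega> :: "(real ^ 'd::finite) set" +
  fixes Vh :: "(real ^ 'd \<Rightarrow> real) set" and \<epsilon> \<Delta>t :: real and H :: "real \<Rightarrow> real"
    and u_prev u U :: "real ^ 'd \<Rightarrow> real"
  assumes Vh_subset: "Vh \<subseteq> C0 \<Omega> \<inter> H1 \<Omega>"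
    and Vh_lincomb: "\<And>v w s t. v \<in> Vh \<Longrightarrow> w \<in> Vh \<Longrightarrow> (\<lambda>x. s * v x + t * w x) \<in> Vh"
    and \<Delta>t_pos: "\<Delta>t > 0"
    and u_Vh: "u \<in> Vh" and U_C0: "U \<in> C0 \<Omega>"
    and H_continuous: "continuous_on (closure \<Omega>) (\<lambda>x. H (extrapolate u_prev u x))"
begin

abbreviation h :: "real ^ 'd \<Rightarrow> real" where "h x \<equiv> H (extrapolate u_prev u x)"

abbreviation solution :: "(real ^ 'd \<Rightarrow> real) \<Rightarrow> (real ^ 'd \<Rightarrow> real) \<Rightarrow> bool" where
  "solution \<equiv> scheme_solution \<Omega> Vh \<epsilon> H \<Delta>t u_prev u U"

lemma Vh_continuous: "v \<in> Vh \<Longrightarrow> continuous_on (closure \<Omega>) v"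
  using Vh_subset by (auto simp: C0_def)

lemmas data_continuous = Vh_continuous H_continuous U_C0[unfolded C0_def mem_Collect_eq]

lemma midpt_lincomb: "midpt f g = (\<lambda>x. 1/2 * f x + 1/2 * g x)"
  by (simp add: midpt_def[abs_def] add_divide_distrib)

lemma midpt_Vh: "u' \<in> Vh \<Longrightarrow> midpt u u' \<in> Vh"
  unfolding midpt_lincomb by (intro Vh_lincomb u_Vh)

text \<open>Inserting \<open>U' = U + h (w - u)\<close> with \<open>w = midpt u u'\<close> into the variational equation leaves a linear
  problem for \<open>w\<close> alone. The mass term of the time derivative and the term \<open>h\<^sup>2 w / 2\<close> coming from the
  potential have been merged into one weight.\<close>

definition reduced_form :: "(real ^ 'd \<Rightarrow> real) \<Rightarrow> (real ^ 'd \<Rightarrow> real) \<Rightarrow> real" where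
  "reduced_form w \<phi> = l2_inner \<Omega> (\<lambda>x. (2 / \<Delta>t + (h x)\<^sup>2 / 2) * w x) \<phi> + A_form \<Omega> (\<lambda>_. \<epsilon>\<^sup>2) w \<phi>"

definition reduced_load :: "(real ^ 'd \<Rightarrow> real) \<Rightarrow> real" where
  "reduced_load \<phi> = l2_inner \<Omega> (\<lambda>x. (2 / \<Delta>t + (h x)\<^sup>2 / 2) * u x - h x * U x) \<phi>"

lemma l2_inner_lincomb:
  assumes "continuous_on (closure \<Omega>) f" "continuous_on (closure \<Omega>) g" "continuous_on (closure \<Omega>) \<phi>"
  shows "l2_inner \<Omega> (\<lambda>x. s * f x + t * g x) \<phi> = s * l2_inner \<Omega> f \<phi> + t * l2_inner \<Omega> g \<phi>"
proof -
  have "integrable (lebesgue_on \<Omega>) (\<lambda>x. f x * \<phi> x)" "integrable (lebesgue_on \<Omega>) (\<lambda>x. g x * \<phi> x)"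
    using assms by (auto intro!: continuous_on_closure_integrable continuous_intros)
  then show ?thesis by (simp add: l2_inner_def algebra_simps)
qed

lemma l2_inner_commute: "l2_inner \<Omega> f g = l2_inner \<Omega> g f"
  by (simp add: l2_inner_def mult.commute)

lemma l2_inner_cong: "(\<And>x. x \<in> closure \<Omega> \<Longrightarrow> f x = f' x) \<Longrightarrow> l2_inner \<Omega> f \<phi> = l2_inner \<Omega> f' \<phi>"
  unfolding l2_inner_def using closure_subset by (intro Bochner_Integration.integral_cong) auto

lemma reduced_form_lincomb:
  assumes "v \<in> Vh" "w \<in> Vh" "\<phi> \<in> Vh"
  shows "reduced_form (\<lambda>x. s * v x + t * w x) \<phi> = s * reduced_form v \<phi> + t * reduced_form w \<phi>"
proof -
  have split: "(\<lambda>x. m x * (s * v x + t * w x)) = (\<lambda>x. s * (m x * v x) + t * (m x * w x))" for m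
    by (simp add: algebra_simps)
  have "l2_inner \<Omega> (\<lambda>x. s * ((2 / \<Delta>t + (h x)\<^sup>2 / 2) * v x) + t * ((2 / \<Delta>t + (h x)\<^sup>2 / 2) * w x)) \<phi>
      = s * l2_inner \<Omega> (\<lambda>x. (2 / \<Delta>t + (h x)\<^sup>2 / 2) * v x) \<phi> + t * l2_inner \<Omega> (\<lambda>x. (2 / \<Delta>t + (h x)\<^sup>2 / 2) * w x) \<phi>"
    using assms \<Delta>t_pos by (intro l2_inner_lincomb continuous_intros data_continuous) auto
  moreover have "A_form \<Omega> (\<lambda>_. \<epsilon>\<^sup>2) (\<lambda>x. s * v x + t * w x) \<phi>
      = s * A_form \<Omega> (\<lambda>_. \<epsilon>\<^sup>2) v \<phi> + t * A_form \<Omega> (\<lambda>_. \<epsilon>\<^sup>2) w \<phi>"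
    using assms Vh_subset by (intro A_form_lincomb) auto
  ultimately show ?thesis unfolding reduced_form_def split by (simp add: distrib_left)
qed

lemma reduced_form_commute: "reduced_form v w = reduced_form w v"
  by (simp add: reduced_form_def A_form_commute l2_inner_def mult.commute mult.left_commute)

text \<open>All three contributions are nonnegative for every time step; the mass term alone makes the form
  definite on the closure of the domain.\<close>

lemma reduced_form_positive:
  assumes v: "v \<in> Vh" and x: "x \<in> closure \<Omega>" "v x \<noteq> 0"
  shows "reduced_form v v > 0"
proof -
  have int: "integrable (lebesgue_on \<Omega>) (\<lambda>x. 2 / \<Delta>t * (v x)\<^sup>2)"
    "integrable (lebesgue_on \<Omega>) (\<lambda>x. (2 / \<Delta>t + (h x)\<^sup>2 / 2) * v x * v x)"
    using v \<Delta>t_pos by (intro continuous_on_closure_integrable continuous_intros data_continuous; simp)+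
  have "(LINT x|lebesgue_on \<Omega>. (v x)\<^sup>2) \<noteq> 0"
    using continuous_square_integral_zero[OF Vh_continuous[OF v] _ x(1)] x(2) by blast
  moreover have "(LINT x|lebesgue_on \<Omega>. (v x)\<^sup>2) \<ge> 0" by simp
  ultimately have "(LINT x|lebesgue_on \<Omega>. (v x)\<^sup>2) > 0" by linarith
  then have "0 < 2 / \<Delta>t * (LINT x|lebesgue_on \<Omega>. (v x)\<^sup>2)" using \<Delta>t_pos by simp
  also have "\<dots> = (LINT x|lebesgue_on \<Omega>. 2 / \<Delta>t * (v x)\<^sup>2)" by simp
  also have "\<dots> \<le> (LINT x|lebesgue_on \<Omega>. (2 / \<Delta>t + (h x)\<^sup>2 / 2) * v x * v x)"
  proof (rule integral_mono[OF int])
    fix x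
    have "(2 / \<Delta>t + (h x)\<^sup>2 / 2) * v x * v x = 2 / \<Delta>t * (v x)\<^sup>2 + (h x)\<^sup>2 / 2 * (v x)\<^sup>2"
      by (simp add: distrib_right power2_eq_square[of "v x"])
    then show "2 / \<Delta>t * (v x)\<^sup>2 \<le> (2 / \<Delta>t + (h x)\<^sup>2 / 2) * v x * v x" by simp
  qed
  also have "\<dots> \<le> reduced_form v v"
    using A_form_nonneg[of "\<epsilon>\<^sup>2" v] by (simp add: reduced_form_def l2_inner_def)
  finally show ?thesis .
qed

lemma reduced_form_zero:
  assumes "v \<in> Vh" "w \<in> Vh" "\<And>x. x \<in> closure \<Omega> \<Longrightarrow> v x = 0"
  shows "reduced_form v w = 0"
proof -
  have "A_form \<Omega> (\<lambda>_. \<epsilon>\<^sup>2) v w = 0"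
    using assms Vh_subset closure_subset[of \<Omega>] by (intro A_form_zero) auto
  moreover have "l2_inner \<Omega> (\<lambda>x. (2 / \<Delta>t + (h x)\<^sup>2 / 2) * v x) w = l2_inner \<Omega> (\<lambda>_. 0) w"
    using assms by (intro l2_inner_cong) simp
  ultimately show ?thesis by (simp add: reduced_form_def l2_inner_def)
qed

lemma reduced_load_lincomb:
  assumes "v \<in> Vh" "w \<in> Vh"
  shows "reduced_load (\<lambda>x. s * v x + t * w x) = s * reduced_load v + t * reduced_load w"
proof -
  have "continuous_on (closure \<Omega>) (\<lambda>x. (2 / \<Delta>t + (h x)\<^sup>2 / 2) * u x - h x * U x)"
    using \<Delta>t_pos u_Vh by (intro continuous_intros data_continuous) auto
  from l2_inner_lincomb[OF Vh_continuous Vh_continuous this] assms show ?thesis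
    by (simp add: reduced_load_def l2_inner_commute[of "\<lambda>x. (2 / \<Delta>t + (h x)\<^sup>2 / 2) * u x - h x * U x"])
qed

lemma reduced_load_zero:
  assumes "\<And>x. x \<in> closure \<Omega> \<Longrightarrow> v x = 0"
  shows "reduced_load v = 0"
  using l2_inner_cong[of v "\<lambda>_. 0"] assms
  by (subst reduced_load_def, subst l2_inner_commute) (simp add: l2_inner_def)

lemma potential_update_iff:
  "(midpt U U' x - U x) / (1/2 * \<Delta>t) = 1/2 * h x * ((w - u x) / (1/2 * \<Delta>t)) \<longleftrightarrow>
    U' x = U x + h x * (w - u x)"
  using \<Delta>t_pos by (simp add: midpt_def field_simps) argo

text \<open>The equivalence is exact, so existence and uniqueness both reduce to the problem for the midpoint.\<close>

lemma solution_iff_reduced: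
  "solution u' U' \<longleftrightarrow> u' \<in> Vh \<and> U' \<in> C0 \<Omega> \<and>
     (\<forall>\<phi>\<in>Vh. reduced_form (midpt u u') \<phi> = reduced_load \<phi>) \<and>
     (\<forall>x\<in>closure \<Omega>. U' x = U x + h x * (midpt u u' x - u x))"
proof -
  let ?w = "midpt u u'"
  have "l2_inner \<Omega> (\<lambda>x. (?w x - u x) / (1/2 * \<Delta>t)) \<phi> =
        - A_form \<Omega> (\<lambda>_. \<epsilon>\<^sup>2) ?w \<phi> - l2_inner \<Omega> (\<lambda>x. h x * midpt U U' x) \<phi> \<longleftrightarrow>
      reduced_form ?w \<phi> = reduced_load \<phi>"
    if u': "u' \<in> Vh" and U': "U' \<in> C0 \<Omega>" and \<phi>: "\<phi> \<in> Vh"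
      and update: "\<forall>x\<in>closure \<Omega>. U' x = U x + h x * (?w x - u x)" for \<phi>
  proof -
    let ?m = "\<lambda>x. 2 / \<Delta>t + (h x)\<^sup>2 / 2"
    have w: "?w \<in> Vh" using u' by (rule midpt_Vh)
    note cont = Vh_continuous[OF w] Vh_continuous[OF u_Vh] Vh_continuous[OF \<phi>]
      H_continuous U_C0[unfolded C0_def mem_Collect_eq] U'[unfolded C0_def mem_Collect_eq]
    have "l2_inner \<Omega> (\<lambda>x. (?w x - u x) / (1/2 * \<Delta>t)) \<phi> + l2_inner \<Omega> (\<lambda>x. h x * midpt U U' x) \<phi> =
        l2_inner \<Omega> (\<lambda>x. 1 * ((?w x - u x) / (1/2 * \<Delta>t)) + 1 * (h x * midpt U U' x)) \<phi>"
      using \<Delta>t_pos unfolding midpt_def[of U]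
      by (subst l2_inner_lincomb) (auto intro!: continuous_intros cont)
    also have "\<dots> = l2_inner \<Omega> (\<lambda>x. 1 * (?m x * ?w x) + (-1) * (?m x * u x - h x * U x)) \<phi>"
    proof (rule l2_inner_cong)
      fix x assume "x \<in> closure \<Omega>"
      then have "U' x = U x + h x * (?w x - u x)" using update by blast
      then have mid: "midpt U U' x = U x + h x * (?w x - u x) / 2"
        by (simp add: midpt_def[of U] field_simps)
      show "1 * ((?w x - u x) / (1/2 * \<Delta>t)) + 1 * (h x * midpt U U' x) =
          1 * (?m x * ?w x) + (-1) * (?m x * u x - h x * U x)"
        unfolding mid using \<Delta>t_pos by (simp add: field_simps power2_eq_square)
    qed
    also have "\<dots> = l2_inner \<Omega> (\<lambda>x. ?m x * ?w x) \<phi> - reduced_load \<phi>"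
      unfolding reduced_load_def using \<Delta>t_pos
      by (subst l2_inner_lincomb) (auto intro!: continuous_intros cont)
    finally show ?thesis by (auto simp: reduced_form_def)
  qed
  then show ?thesis
    unfolding scheme_solution_def potential_update_iff by blast
qed

lemma solution_exists:
  assumes "finite J" "\<And>v. v \<in> Vh \<Longrightarrow> \<exists>c. \<forall>x\<in>closure \<Omega>. v x = (\<Sum>j\<in>J. c j * b j x)"
  shows "\<exists>u' U'. solution u' U'"
proof -
  have "\<exists>w\<in>Vh. \<forall>\<phi>\<in>Vh. reduced_form w \<phi> = reduced_load \<phi>"
  proof (rule finite_dimensional_riesz[OF assms(1) _ Vh_lincomb assms(2) reduced_form_commute
        reduced_form_lincomb reduced_form_positive reduced_form_zero reduced_load_lincomb reduced_load_zero])
    show "(\<lambda>_. 0) \<in> Vh" using Vh_lincomb[OF u_Vh u_Vh, of 0 0] by simp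
  qed
  then obtain w where w: "w \<in> Vh" "\<And>\<phi>. \<phi> \<in> Vh \<Longrightarrow> reduced_form w \<phi> = reduced_load \<phi>" by blast
  \<comment> \<open>Chosen such that \<open>w\<close> is the midpoint of \<open>u\<close> and \<open>u'\<close>.\<close>
  define u' where "u' = (\<lambda>x. 2 * w x + (-1) * u x)"
  define U' where "U' = (\<lambda>x. U x + h x * (w x - u x))"
  have "u' \<in> Vh" unfolding u'_def by (intro Vh_lincomb w u_Vh)
  moreover have "midpt u u' = w" by (auto simp: midpt_def u'_def)
  moreover have "U' \<in> C0 \<Omega>"
    unfolding C0_def U'_def mem_Collect_eq using w(1) u_Vh
    by (intro continuous_intros data_continuous) auto
  ultimately have "solution u' U'" using w by (simp add: solution_iff_reduced U'_def)
  then show ?thesis by blast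
qed

lemma solution_unique:
  assumes 1: "solution u1 U1" and 2: "solution u2 U2" and x: "x \<in> closure \<Omega>"
  shows "u1 x = u2 x \<and> U1 x = U2 x"
proof -
  let ?w1 = "midpt u u1" and ?w2 = "midpt u u2"
  have w: "?w1 \<in> Vh" "?w2 \<in> Vh" using 1 2 midpt_Vh by (auto simp: solution_iff_reduced)
  define d where "d = (\<lambda>x. 1 * ?w1 x + (-1) * ?w2 x)"
  have d: "d \<in> Vh" unfolding d_def by (intro Vh_lincomb w)
  have "reduced_form d d = 1 * reduced_form ?w1 d + (-1) * reduced_form ?w2 d"
    using reduced_form_lincomb[OF w d, of 1 "-1"] by (simp add: d_def)
  also have "\<dots> = 0" using 1 2 d by (simp add: solution_iff_reduced)
  finally have "d x = 0" using reduced_form_positive[OF d x] by force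
  then have "?w1 x = ?w2 x" by (simp add: d_def)
  moreover from this have "u1 x = u2 x" by (simp add: midpt_def)
  ultimately show ?thesis using 1 2 x by (simp add: solution_iff_reduced)
qed

text \<open>Testing with the increment \<open>u' - u\<close> turns each term into a difference. By symmetry, the bilinear form at
  the midpoint and the increment is half the difference of the two quadratic forms. The pointwise update
  says \<open>h (u' - u) = 2 (U' - U)\<close>, and \<open>(U' + U) (U' - U)\<close> is a difference of squares.\<close>

lemma energy_dissipation:
  assumes sol: "solution u' U'"
  shows "energy \<Omega> \<epsilon> B u' U' = energy \<Omega> \<epsilon> B u U - 1 / \<Delta>t * (l2_norm \<Omega> (\<lambda>x. u' x - u x))\<^sup>2"
proof -
  let ?A = "A_form \<Omega> (\<lambda>_. \<epsilon>\<^sup>2)" and ?e = "\<lambda>x. 1 * u' x + (-1) * u x"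
  have u': "u' \<in> Vh" and U': "U' \<in> C0 \<Omega>" using sol by (auto simp: solution_iff_reduced)
  have U'_cont: "continuous_on (closure \<Omega>) U'" using U' by (simp add: C0_def)
  have e: "?e \<in> Vh" by (intro Vh_lincomb u' u_Vh)
  have H1: "u \<in> C0 \<Omega> \<inter> H1 \<Omega>" "u' \<in> C0 \<Omega> \<inter> H1 \<Omega>" "?e \<in> C0 \<Omega> \<inter> H1 \<Omega>"
    using u_Vh u' e Vh_subset by auto
  have norm: "l2_inner \<Omega> (\<lambda>x. (midpt u u' x - u x) / (1/2 * \<Delta>t)) ?e
      = 1 / \<Delta>t * (l2_norm \<Omega> (\<lambda>x. u' x - u x))\<^sup>2"
  proof -
    have "l2_inner \<Omega> (\<lambda>x. u' x - u x) (\<lambda>x. u' x - u x) \<ge> 0" by (simp add: l2_inner_def)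
    then have "(l2_norm \<Omega> (\<lambda>x. u' x - u x))\<^sup>2 = l2_inner \<Omega> (\<lambda>x. u' x - u x) (\<lambda>x. u' x - u x)"
      by (simp add: l2_norm_def)
    moreover have "(midpt u u' x - u x) / (1/2 * \<Delta>t) * ?e x = 1 / \<Delta>t * ((u' x - u x) * (u' x - u x))" for x
      using \<Delta>t_pos by (simp add: midpt_def field_simps)
    ultimately show ?thesis unfolding l2_inner_def by (simp only: integral_mult_right_zero)
  qed
  have mid: "?A (midpt u u') ?e = 1/2 * ?A u ?e + 1/2 * ?A u' ?e"
    unfolding midpt_lincomb by (intro A_form_lincomb H1)
  have right: "?A v ?e = ?A v u' - ?A v u" if "v \<in> C0 \<Omega> \<inter> H1 \<Omega>" for v
    using A_form_lincomb[OF H1(2,1) that, of "\<epsilon>\<^sup>2" 1 "-1"]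
      A_form_commute[of _ v u] A_form_commute[of _ v u'] A_form_commute[of _ v ?e] by simp
  have grad: "?A (midpt u u') ?e = 1/2 * (?A u' u' - ?A u u)"
    unfolding mid right[OF H1(1)] right[OF H1(2)] using A_form_commute[of "\<lambda>_. \<epsilon>\<^sup>2" u u']
    by (simp add: field_simps)
  have potential: "l2_inner \<Omega> (\<lambda>x. h x * midpt U U' x) ?e
      = (LINT x|lebesgue_on \<Omega>. (U' x)\<^sup>2) - (LINT x|lebesgue_on \<Omega>. (U x)\<^sup>2)"
  proof -
    have "h x * midpt U U' x * ?e x = (U' x)\<^sup>2 - (U x)\<^sup>2" if "x \<in> \<Omega>" for x
    proof -
      have "x \<in> closure \<Omega>" using that closure_subset by blast
      then have "U' x - U x = h x * (midpt u u' x - u x)"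
        using sol by (simp add: solution_iff_reduced)
      then have increment: "h x * ?e x = 2 * (U' x - U x)" by (simp add: midpt_def field_simps)
      have "h x * midpt U U' x * ?e x = (h x * ?e x) * midpt U U' x" by (simp only: mult_ac)
      also have "\<dots> = 2 * (U' x - U x) * (1/2 * (U x + U' x))"
        by (simp only: increment midpt_def)
      also have "\<dots> = (U' x)\<^sup>2 - (U x)\<^sup>2" by (simp add: field_simps power2_eq_square)
      finally show ?thesis .
    qed
    then have "l2_inner \<Omega> (\<lambda>x. h x * midpt U U' x) ?e = (LINT x|lebesgue_on \<Omega>. (U' x)\<^sup>2 - (U x)\<^sup>2)"
      unfolding l2_inner_def by (intro Bochner_Integration.integral_cong) auto
    also have "\<dots> = (LINT x|lebesgue_on \<Omega>. (U' x)\<^sup>2) - (LINT x|lebesgue_on \<Omega>. (U x)\<^sup>2)"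
      by (intro Bochner_Integration.integral_diff continuous_on_closure_integrable continuous_intros data_continuous U'_cont)
    finally show ?thesis .
  qed
  have "l2_inner \<Omega> (\<lambda>x. (midpt u u' x - u x) / (1/2 * \<Delta>t)) ?e =
      - ?A (midpt u u') ?e - l2_inner \<Omega> (\<lambda>x. h x * midpt U U' x) ?e"
    using sol e unfolding scheme_solution_def by blast
  then show ?thesis unfolding norm grad potential energy_def by (simp add: algebra_simps)
qed

end

lemma C1_on_H_fun_continuous:
  assumes "C1_on I F F'" and v: "continuous_on S v" and "\<And>x. x \<in> S \<Longrightarrow> v x \<in> I \<and> F (v x) + B > 0"
  shows "continuous_on S (\<lambda>x. H_fun F F' B (v x))"
proof -
  have "continuous_on I F"
    using assms(1) by (auto simp: C1_on_def continuous_on_eq_continuous_within intro: DERIV_continuous)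
  then have "continuous_on S (\<lambda>x. F (v x))" "continuous_on S (\<lambda>x. F' (v x))"
    using assms by (auto simp: C1_on_def intro!: continuous_on_compose2[OF _ v])
  then show ?thesis
    using assms(3) unfolding H_fun_def by (intro continuous_intros) (auto simp: less_imp_neq[symmetric])
qed

theorem theoremB1:
  fixes \<Omega> :: "(real ^ 'd::finite) set"
    and \<T> :: "(real ^ 'd) set set"
    and k :: nat
    and \<epsilon> B \<Delta>t \<rho> :: real
    and F F' :: "real \<Rightarrow> real"
    and I :: "real set"
    and u_prev u U :: "real ^ 'd \<Rightarrow> real"
  assumes dim: "CARD('d) = 2 \<or> CARD('d) = 3"
    and domain: "bounded_domain \<Omega>"
    and mesh: "domain_triangulation \<Omega> \<T>"
    and quasi_unif: "\<rho> > 0" "quasi_uniform \<rho> \<T>"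
    and degree: "k \<ge> 1"
    and eps: "\<epsilon> > 0"
    and potential: "is_interval I" "C1_on I F F'"
    and B_nonneg: "B \<ge> 0"
    and time_step: "\<Delta>t > 0"
    and data: "u_prev \<in> fe_space \<Omega> \<T> k" "u \<in> fe_space \<Omega> \<T> k" "U \<in> C0 \<Omega>"
    and admissible: "\<forall>x\<in>closure \<Omega>. extrapolate u_prev u x \<in> I \<and> F (extrapolate u_prev u x) + B > 0"
  shows "(\<exists>u' U'. scheme_solution \<Omega> (fe_space \<Omega> \<T> k) \<epsilon> (H_fun F F' B) \<Delta>t u_prev u U u' U') \<and>
    (\<forall>u1 U1 u2 U2.
       scheme_solution \<Omega> (fe_space \<Omega> \<T> k) \<epsilon> (H_fun F F' B) \<Delta>t u_prev u U u1 U1 \<and>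
       scheme_solution \<Omega> (fe_space \<Omega> \<T> k) \<epsilon> (H_fun F F' B) \<Delta>t u_prev u U u2 U2 \<longrightarrow>
       (\<forall>x\<in>closure \<Omega>. u1 x = u2 x \<and> U1 x = U2 x)) \<and>
    (\<forall>u' U'.
       scheme_solution \<Omega> (fe_space \<Omega> \<T> k) \<epsilon> (H_fun F F' B) \<Delta>t u_prev u U u' U' \<longrightarrow>
       energy \<Omega> \<epsilon> B u' U' =
         energy \<Omega> \<epsilon> B u U - 1 / \<Delta>t * (l2_norm \<Omega> (\<lambda>x. u' x - u x))\<^sup>2)"
proof -
  interpret bounded_open \<Omega>
    using domain by unfold_locales (auto simp: bounded_domain_def)
  have "continuous_on (closure \<Omega>) (extrapolate u_prev u)"
    using data unfolding extrapolate_def[abs_def]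
    by (auto simp: fe_space_def C0_def intro!: continuous_intros)
  then have "continuous_on (closure \<Omega>) (\<lambda>x. H_fun F F' B (extrapolate u_prev u x))"
    using C1_on_H_fun_continuous[OF potential(2)] admissible by blast
  then interpret scheme_step \<Omega> "fe_space \<Omega> \<T> k" \<epsilon> \<Delta>t "H_fun F F' B" u_prev u U
  proof unfold_locales
    show "fe_space \<Omega> \<T> k \<subseteq> C0 \<Omega> \<inter> H1 \<Omega>" by (auto simp: fe_space_def)
  qed (use time_step data fe_space_lincomb in auto)
  have "finite \<T>" "closure \<Omega> \<subseteq> \<Union>\<T>"
    using mesh by (auto simp: domain_triangulation_def triangulation_def)
  then obtain J and b :: "(real ^ 'd) set \<times> ('d \<Rightarrow> nat) \<Rightarrow> real ^ 'd \<Rightarrow> real" where J: "finite J"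
    and b: "\<And>v. v \<in> fe_space \<Omega> \<T> k \<Longrightarrow> \<exists>c. \<forall>x\<in>closure \<Omega>. v x = (\<Sum>j\<in>J. c j * b j x)"
    using fe_space_finite_generators[of \<T> \<Omega> k] by blast
  show ?thesis
  proof (intro conjI allI impI ballI)
    show "\<exists>u' U'. solution u' U'" by (rule solution_exists[OF J b])
  qed (use solution_unique energy_dissipation in blast)+
qed

end
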